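(* Let $\mathcal C\subseteq NC^{\circ\bullet}$ be a globally colorized category of noncrossing two-colored partitions. Then $\mathcal C$ coincides with one of the following categories (listed according to the case $\mathcal O,\mathcal H,\mathcal S,\mathcal B$ in which $\mathcal C$ lies). - Case $\mathcal O$: $\mathcal O_{\mathrm{glob}}(k)=\langle \pi_{\circ\circ}^{\otimes k/2},\ \pi_{\circ\circ}\otimes\pi_{\bullet\bullet}\rangle$ for some $k\in 2\mathbb N_0$. - Case $\mathcal H$: $\mathcal H_{\mathrm{glob}}(k)=\langle b_k,\ \beta_{\circ\bullet\circ\bullet},\ \pi_{\circ\circ}\otimes\pi_{\bullet\bullet}\rangle$ for some $k\in 2\mathbb N_0$. - Case $\mathcal S$: $\mathcal S_{\mathrm{glob}}(k)=\langle \sigma_\circ^{\otimes k},\ \beta_{\circ\bullet\circ\bullet},\ \sigma_\circ\otimes\sigma_\bullet,\ \pi_{\circ\circ}\otimes\pi_{\bullet\bullet}\rangle$ for some $k\in\mathbb N_0$. - Case $\mathcal B$: $\mathcal B_{\mathrm{glob}}(k)=\langle \sigma_\circ^{\otimes k},\ \sigma_\circ\otimes\sigma_\bullet,\ \pi_{\circ\circ}\otimes\pi_{\bullet\bullet}\rangle$ for some $k\in 2\mathbb N_0$, or $\mathcal B'_{\mathrm{glob}}(k)=\langle \sigma_\circ^{\otimes k},\ \lambda_1,\ \sigma_\circ\otimes\sigma_\bullet,\ \pi_{\circ\circ}\otimes\pi_{\bullet\bullet}\rangle$ for some $k\in\mathbb N_0$.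
   Context: $\mathbb N_0=\{0,1,2,\dots\}$. Two-colored partitions: for $k,l\in\mathbb N_0$, $P^{\circ\bullet}(k,l)$ is the set of all decompositions into disjoint nonempty blocks of a set consisting of a row of $k$ upper points and a row of $l$ lower points, where each point is moreover colored white ($\circ$) or black ($\bullet$); these two colors are inverse to each other. $P^{\circ\bullet}$ is the collection of all $P^{\circ\bullet}(k,l)$. $NC^{\circ\bullet}\subseteq P^{\circ\bullet}$ consists of the noncrossing partitions, i.e. those whose blocks can be drawn by strings between the two rows without crossings. Operations: the tensor product $p\otimes q$ is horizontal concatenation. The composition $pq\in P^{\circ\bullet}(k,m)$ of $q\in P^{\circ\bullet}(k,l)$ and $p\in P^{\circ\bullet}(l,m)$, defined only if the color of the $j$-th lower point of $q$ equals the color of the $j$-th upper point of $p$ for all $j$, is obtained by placing $p$ below $q$, joining blocks through the $l$ middle points, and removing the middle points. The involution $p^*\in P^{\circ\bullet}(l,k)$ of $p\in P^{\circ\bullet}(k,l)$ is the reflection at the horizontal axis (colors kept). A category of partitions is a collection $\mathcal C$ of subsets $\mathcal C(k,l)\subseteq P^{\circ\bullet}(k,l)$, $k,l\in\mathbb N_0$, closed under tensor product, composition and involution, and containing the pair partitions $\pi_{\circ\bullet},\pi_{\bullet\circ}$ and the identity partitions in $P^{\circ\bullet}(1,1)$ connecting one upper point with one lower point of the same color (both white, or both black). $\langle p_1,\dots,p_n\rangle$ is the smallest category of partitions containing $p_1,\dots,p_n$. Special partitions (all on the lower row only, read from left to right): $\pi_{xy}\in P^{\circ\bullet}(0,2)$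 is one block of two points colored $x,y$; $\beta_{xyzw}\in P^{\circ\bullet}(0,4)$ is one block of four points colored $x,y,z,w$; $\sigma_\circ,\sigma_\bullet\in P^{\circ\bullet}(0,1)$ are the single white, resp. black, point; $b_s\in P^{\circ\bullet}(0,s)$ is one block of $s$ white points; $\lambda_1\in P^{\circ\bullet}(0,4)$ has colors $\circ\circ\bullet\bullet$, the second and fourth points form a block, and the first and third points are singletons. By convention $b_0=\emptyset$ and $p^{\otimes 0}=\emptyset$ (the empty partition). Cases: $\mathcal C$ is in case $\mathcal O$ if $\sigma_\circ\otimes\sigma_\bullet\notin\mathcal C$ and $\beta_{\circ\bullet\circ\bullet}\notin\mathcal C$; in case $\mathcal B$ if $\sigma_\circ\otimes\sigma_\bullet\in\mathcal C$ and $\beta_{\circ\bullet\circ\bullet}\notin\mathcal C$; in case $\mathcal H$ if $\sigma_\circ\otimes\sigma_\bullet\notin\mathcal C$ and $\beta_{\circ\bullet\circ\bullet}\in\mathcal C$; in case $\mathcal S$ if both are in $\mathcal C$. $\mathcal C$ is globally colorized if $\pi_{\circ\circ}\otimes\pi_{\bullet\bullet}\in\mathcal C$, and locally colorized otherwise. *)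

theory Defs
  imports "HOL-Library.Disjoint_Sets"
begin

datatype color = White | Black

text \<open>Points of a row are numbered from left to right, starting with 0.\<close>

datatype point = Upper nat | Lower nat

datatype partition =
  Partition (upper_colors: "color list") (lower_colors: "color list") (blocks: "point set set")

definition points :: "nat \<Rightarrow> nat \<Rightarrow> point set" where
  "points k l = Upper ` {..<k} \<union> Lower ` {..<l}"

definition two_colored :: "nat \<Rightarrow> nat \<Rightarrow> partition set" where
  "two_colored k l =
    {p. length (upper_colors p) = k \<and> length (lower_colors p) = l \<and>
        partition_on (points k l) (blocks p)}"

definition all_two_colored :: "partition set" where
  "all_two_colored = (\<Union>k l. two_colored k l)"


text \<open>Going clockwise around the strip between the two rows, one meets the upper points
  from left to right and then the lower points from right to left. The blocks can be drawn
  without crossings iff no two of them alternate in this circular order.\<close>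

fun clockwise :: "partition \<Rightarrow> point \<Rightarrow> nat" where
  "clockwise p (Upper i) = i"
| "clockwise p (Lower j) = length (upper_colors p) + (length (lower_colors p) - 1 - j)"

definition crossing :: "partition \<Rightarrow> bool" where
  "crossing p \<longleftrightarrow>
    (\<exists>A \<in> blocks p. \<exists>B \<in> blocks p. A \<noteq> B \<and>
      (\<exists>a \<in> A. \<exists>b \<in> B. \<exists>c \<in> A. \<exists>d \<in> B.
         clockwise p a < clockwise p b \<and> clockwise p b < clockwise p c \<and>
         clockwise p c < clockwise p d))"

definition noncrossing :: "partition set" where
  "noncrossing = {p \<in> all_two_colored. \<not> crossing p}"


fun shift :: "nat \<Rightarrow> nat \<Rightarrow> point \<Rightarrow> point" where
  "shift k l (Upper i) = Upper (k + i)"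
| "shift k l (Lower j) = Lower (l + j)"

definition tensor :: "partition \<Rightarrow> partition \<Rightarrow> partition"  (infixr "\<otimes>" 70) where
  "p \<otimes> q =
    Partition (upper_colors p @ upper_colors q) (lower_colors p @ lower_colors q)
      (blocks p \<union>
       (`) (shift (length (upper_colors p)) (length (lower_colors p))) ` blocks q)"

definition empty_partition :: partition where
  "empty_partition = Partition [] [] {}"

primrec tensor_power :: "partition \<Rightarrow> nat \<Rightarrow> partition" where
  "tensor_power p 0 = empty_partition"
| "tensor_power p (Suc n) = p \<otimes> tensor_power p n"

text \<open>In the stacked diagram of a composition the outer points are tagged \<open>Inl\<close>, and the
  \<open>j\<close>-th middle point is \<open>Inr j\<close>; it is a lower point of the partition placed on top and
  an upper point of the one placed at the bottom.\<close>

fun on_top :: "point \<Rightarrow> point + nat" where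
  "on_top (Upper i) = Inl (Upper i)"
| "on_top (Lower j) = Inr j"

fun at_bottom :: "point \<Rightarrow> point + nat" where
  "at_bottom (Upper j) = Inr j"
| "at_bottom (Lower i) = Inl (Lower i)"

definition joined :: "partition \<Rightarrow> partition \<Rightarrow> (point + nat) rel" where
  "joined p q =
    ((\<Union>B \<in> blocks q. on_top ` B \<times> on_top ` B) \<union>
     (\<Union>B \<in> blocks p. at_bottom ` B \<times> at_bottom ` B))\<^sup>*"

definition composable :: "partition \<Rightarrow> partition \<Rightarrow> bool" where
  "composable p q \<longleftrightarrow> lower_colors q = upper_colors p"

text \<open>The composition \<open>pq\<close>, where \<open>p\<close> is placed below \<open>q\<close>; meaningful only if
  \<open>composable p q\<close>.\<close>

definition composition :: "partition \<Rightarrow> partition \<Rightarrow> partition" where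
  "composition p q =
    Partition (upper_colors q) (lower_colors p)
      (points (length (upper_colors q)) (length (lower_colors p)) //
        {(x, y). (Inl x, Inl y) \<in> joined p q})"

fun reflect :: "point \<Rightarrow> point" where
  "reflect (Upper i) = Lower i"
| "reflect (Lower j) = Upper j"

definition involution :: "partition \<Rightarrow> partition" where
  "involution p = Partition (lower_colors p) (upper_colors p) ((`) reflect ` blocks p)"


definition id_part :: "color \<Rightarrow> partition" where
  "id_part x = Partition [x] [x] {{Upper 0, Lower 0}}"

text \<open>All points on the lower row, in one block. For the empty word there is no block, as
  blocks are nonempty.\<close>

definition lower_block :: "color list \<Rightarrow> partition" where
  "lower_block cs = Partition [] cs (if cs = [] then {} else {Lower ` {..<length cs}})"

definition pair_part :: "color \<Rightarrow> color \<Rightarrow> partition"  ("\<pi>") where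
  "\<pi> x y = lower_block [x, y]"

definition four_block :: "color \<Rightarrow> color \<Rightarrow> color \<Rightarrow> color \<Rightarrow> partition"  ("\<beta>") where
  "\<beta> x y z w = lower_block [x, y, z, w]"

definition singleton_part :: "color \<Rightarrow> partition"  ("\<sigma>") where
  "\<sigma> x = lower_block [x]"

definition white_block :: "nat \<Rightarrow> partition" where
  "white_block s = lower_block (replicate s White)"

definition lambda1 :: partition where
  "lambda1 =
    Partition [] [White, White, Black, Black] {{Lower 0}, {Lower 1, Lower 3}, {Lower 2}}"


text \<open>A family of subsets \<open>C k l \<subseteq> two_colored k l\<close> is encoded as its union. Nothing is lost,
  as a partition determines \<open>k\<close> and \<open>l\<close>.\<close>

definition category :: "partition set \<Rightarrow> bool" where
  "category C \<longleftrightarrow>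
    C \<subseteq> all_two_colored \<and>
    (\<forall>p \<in> C. \<forall>q \<in> C. p \<otimes> q \<in> C) \<and>
    (\<forall>p \<in> C. \<forall>q \<in> C. composable p q \<longrightarrow> composition p q \<in> C) \<and>
    (\<forall>p \<in> C. involution p \<in> C) \<and>
    \<pi> White Black \<in> C \<and> \<pi> Black White \<in> C \<and>
    id_part White \<in> C \<and> id_part Black \<in> C"

definition generated :: "partition set \<Rightarrow> partition set" where
  "generated X = \<Inter> {C. category C \<and> X \<subseteq> C}"

definition case_O :: "partition set \<Rightarrow> bool" where
  "case_O C \<longleftrightarrow> \<sigma> White \<otimes> \<sigma> Black \<notin> C \<and> \<beta> White Black White Black \<notin> C"

definition case_B :: "partition set \<Rightarrow> bool" where
  "case_B C \<longleftrightarrow> \<sigma> White \<otimes> \<sigma> Black \<in> C \<and> \<beta> White Black White Black \<notin> C"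

definition case_H :: "partition set \<Rightarrow> bool" where
  "case_H C \<longleftrightarrow> \<sigma> White \<otimes> \<sigma> Black \<notin> C \<and> \<beta> White Black White Black \<in> C"

definition case_S :: "partition set \<Rightarrow> bool" where
  "case_S C \<longleftrightarrow> \<sigma> White \<otimes> \<sigma> Black \<in> C \<and> \<beta> White Black White Black \<in> C"

definition globally_colorized :: "partition set \<Rightarrow> bool" where
  "globally_colorized C \<longleftrightarrow> \<pi> White White \<otimes> \<pi> Black Black \<in> C"

definition O_glob :: "nat \<Rightarrow> partition set" where
  "O_glob k =
    generated {tensor_power (\<pi> White White) (k div 2), \<pi> White White \<otimes> \<pi> Black Black}"

definition H_glob :: "nat \<Rightarrow> partition set" where
  "H_glob k =
    generated {white_block k, \<beta> White Black White Black, \<pi> White White \<otimes> \<pi> Black Black}"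

definition S_glob :: "nat \<Rightarrow> partition set" where
  "S_glob k =
    generated {tensor_power (\<sigma> White) k, \<beta> White Black White Black,
      \<sigma> White \<otimes> \<sigma> Black, \<pi> White White \<otimes> \<pi> Black Black}"

definition B_glob :: "nat \<Rightarrow> partition set" where
  "B_glob k =
    generated {tensor_power (\<sigma> White) k, \<sigma> White \<otimes> \<sigma> Black,
      \<pi> White White \<otimes> \<pi> Black Black}"

definition B'_glob :: "nat \<Rightarrow> partition set" where
  "B'_glob k =
    generated {tensor_power (\<sigma> White) k, lambda1, \<sigma> White \<otimes> \<sigma> Black,
      \<pi> White White \<otimes> \<pi> Black Black}"

end

theory Submission
  imports Defs "HOL-Library.Multiset"
begin

text \<open>
  The argument separates the shape of a partition from its colors. A partition is written by
  labelling its points, two points carrying the same label iff they lie in one block. By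
  bending strings (\<open>labelled_mem_iff_word_mem\<close>) every upper point can be moved to the lower row,
  so that a category is determined by its partitions without upper points, that is by pairs of a
  list of colors and a list of labels. On such words a category is closed under concatenation,
  rotation, reversal and capping, which joins two neighbouring points of inverse colors
  and removes them. Capping is the only composition that has to be computed
  (\<open>composition_capping\<close>).

  If \<open>\<pi> White White \<otimes> \<pi> Black Black\<close> belongs to the category, gluing a rotation of it to two
  neighbouring points of different colors exchanges these colors (\<open>word_swap_end\<close>). Hence the
  colors of a word matter only through the number of white points minus the number of black
  points, its color sum. The color sums form a subgroup \<open>k\<int>\<close> of the integers. The label lists of
  the words with color sum 0, called shapes, can be capped at any two neighbouring points,
  because they may be colored such that these two are inverse. A category is determined by its
  shapes and its color sums: if a word \<open>p\<close> of \<open>C\<close> has the color sum of a word \<open>q\<close> of a smaller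
  category \<open>D\<close>, then \<open>p\<close> followed by the reflection of \<open>q\<close> is a shape of \<open>C\<close>. If this is a shape
  of \<open>D\<close>, append \<open>q\<close> and cap \<open>q\<close> against its reflection; what remains is \<open>p\<close>, now in \<open>D\<close>
  (\<open>subset_if_shapes_subset\<close>).

  It remains to classify families of shapes, which is a problem about uncolored noncrossing
  words of even length. Write \<open>0000\<close>, \<open>01\<close> and \<open>0121\<close> for the shapes of
  \<open>\<beta> White Black White Black\<close>, \<open>\<sigma> White \<otimes> \<sigma> Black\<close> and \<open>lambda1\<close>. These three shapes detect
  all that can happen. A block with at least three points produces \<open>0000\<close>, a block of odd size
  produces \<open>01\<close>, and, without \<open>0000\<close>, two points of one block that enclose an odd number of points
  produce \<open>0121\<close>. Conversely, these shapes rebuild everything that is not excluded in this way: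
  noncrossing words are built by inserting blocks that occupy consecutive positions, and \<open>0121\<close>
  lets singletons move freely, so that blocks of odd size can be inserted two at a time. Without
  \<open>0000\<close> and \<open>0121\<close>, but with \<open>01\<close>, two neighbouring points, each a singleton or both forming a
  block, can be inserted instead, and every word in question arises in this way. Thus the
  category generated by the listed elements has the same shapes and color sums as \<open>C\<close>, where \<open>k\<close> is
  the generator of the group of color sums. An odd \<open>k\<close> forces \<open>01\<close> and \<open>0121\<close>, which is why \<open>k\<close> is
  even in the cases \<open>\<O>\<close> and \<open>\<H>\<close> and for \<open>B_glob\<close>.
\<close>

section \<open>Noncrossing words\<close>

definition noncrossing_word :: "'a list \<Rightarrow> bool" where
  "noncrossing_word xs \<longleftrightarrow> (\<forall>i j k l. i < j \<and> j < k \<and> k < l \<and> l < length xs \<and>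
     xs ! i = xs ! k \<and> xs ! j = xs ! l \<longrightarrow> xs ! i = xs ! j)"

lemma noncrossing_wordD:
  assumes "noncrossing_word xs" "i < j" "j < k" "k < l" "l < length xs" "xs ! i = xs ! k" "xs ! j = xs ! l"
  shows "xs ! i = xs ! j"
  using assms unfolding noncrossing_word_def by blast

lemma noncrossing_remove_infix:
  assumes "noncrossing_word (u @ w @ v)"
  shows "noncrossing_word (u @ v)"
proof -
  define e where "e i = (if i < length u then i else i + length w)" for i
  have nth: "(u @ v) ! i = (u @ w @ v) ! e i" for i
    by (auto simp: e_def nth_append)
  show ?thesis
    unfolding noncrossing_word_def
  proof (intro allI impI, elim conjE)
    fix i j k l
    assume a: "i < j" "j < k" "k < l" "l < length (u @ v)"
      "(u @ v) ! i = (u @ v) ! k" "(u @ v) ! j = (u @ v) ! l"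
    have "(u @ w @ v) ! e i = (u @ w @ v) ! e j"
    proof (rule noncrossing_wordD[OF assms])
      show "e i < e j" "e j < e k" "e k < e l" "e l < length (u @ w @ v)"
        using a by (auto simp: e_def)
    qed (use a nth in auto)
    then show "(u @ v) ! i = (u @ v) ! j" using nth by simp
  qed
qed

text \<open>
  Take a label whose first and last occurrence are as close as possible. A foreign label between
  them could not occur outside without a crossing, so its occurrences would be closer still.
\<close>

lemma noncrossing_interval_block:
  assumes "noncrossing_word xs" "xs \<noteq> []"
  obtains u m a v where "xs = u @ replicate m a @ v" "m > 0" "a \<notin> set (u @ v)"
proof -
  define occ where "occ b = {p. p < length xs \<and> xs ! p = b}" for b
  have fin: "finite (occ b)" for b unfolding occ_def by simp
  define span where "span b = Max (occ b) - Min (occ b)" for b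
  obtain a where a: "a \<in> set xs" and min: "\<And>b. b \<in> set xs \<Longrightarrow> span a \<le> span b"
    using assms(2) ex_min_if_finite[of "span ` set xs"]
    by (smt (verit) arg_min_if_finite(1) arg_min_least finite_set set_empty)
  define i where "i = Min (occ a)"
  define j where "j = Max (occ a)"
  have ne: "occ b \<noteq> {}" if "b \<in> set xs" for b
    using that unfolding occ_def in_set_conv_nth by auto
  have i: "i \<in> occ a" and j: "j \<in> occ a"
    using Min_in[OF fin ne] Max_in[OF fin ne] a unfolding i_def j_def by auto
  have ij: "i \<le> p \<and> p \<le> j" if "p \<in> occ a" for p
    using that fin unfolding i_def j_def by auto
  have all_a: "xs ! p = a" if p: "i \<le> p" "p \<le> j" for p
  proof (rule ccontr)
    assume neq: "xs ! p \<noteq> a"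
    define b where "b = xs ! p"
    have lt: "i < p" "p < j" using p neq i j unfolding occ_def by (auto simp: le_less)
    have plen: "p < length xs" using lt j unfolding occ_def by auto
    have inside: "i < q \<and> q < j" if q: "q \<in> occ b" for q
    proof -
      have qb: "q < length xs" "xs ! q = b" using q unfolding occ_def by auto
      have "q \<noteq> i" "q \<noteq> j" using qb i j neq unfolding occ_def b_def by auto
      moreover have "\<not> q < i"
        using noncrossing_wordD[OF assms(1), of q i p j] i j lt qb neq unfolding occ_def b_def by auto
      moreover have "\<not> j < q"
        using noncrossing_wordD[OF assms(1), of i p j q] i j lt qb neq unfolding occ_def b_def by auto
      ultimately show ?thesis by auto
    qed
    have b: "b \<in> set xs" using plen unfolding b_def by simp
    have "i < Min (occ b)" "Max (occ b) < j"
      using inside Min_in[OF fin ne[OF b]] Max_in[OF fin ne[OF b]] by auto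
    moreover have "Min (occ b) \<le> Max (occ b)" using Min_in[OF fin ne[OF b]] fin by auto
    ultimately have "span b < span a" unfolding span_def i_def[symmetric] j_def[symmetric] by simp
    then show False using min[OF b] by simp
  qed
  have jl: "j < length xs" and ijle: "i \<le> j" using j ij[OF i] unfolding occ_def by auto
  have mid: "take (Suc j - i) (drop i xs) = replicate (Suc j - i) a"
    by (rule nth_equalityI) (use jl ijle all_a in auto)
  have "xs = take i xs @ take (Suc j - i) (drop i xs) @ drop (Suc j) xs"
    using ijle by (metis append_take_drop_id drop_drop le_Suc_eq le_add_diff_inverse2)
  then have dec: "xs = take i xs @ replicate (Suc j - i) a @ drop (Suc j) xs"
    using mid by simp
  have "a \<notin> set (take i xs)" "a \<notin> set (drop (Suc j) xs)"
  proof -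
    show "a \<notin> set (take i xs)"
    proof
      assume "a \<in> set (take i xs)"
      then obtain q where "q < i" "q < length xs" "xs ! q = a"
        by (auto simp: in_set_conv_nth)
      then show False using ij[of q] unfolding occ_def by auto
    qed
    show "a \<notin> set (drop (Suc j) xs)"
    proof
      assume "a \<in> set (drop (Suc j) xs)"
      then obtain q where "q < length (drop (Suc j) xs)" "drop (Suc j) xs ! q = a"
        unfolding in_set_conv_nth by blast
      moreover have "Suc j + q < length xs" using calculation(1) by simp
      ultimately show False using ij[of "Suc j + q"] unfolding occ_def by auto
    qed
  qed
  then show ?thesis using that[OF dec] ijle by simp
qed

lemma noncrossing_induct [consumes 1, case_names Nil block]:
  assumes "noncrossing_word xs"
    and "P []"
    and "\<And>u m a v. noncrossing_word (u @ v) \<Longrightarrow> P (u @ v) \<Longrightarrow> 0 < m \<Longrightarrow> a \<notin> set (u @ v) \<Longrightarrow>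
      P (u @ replicate m a @ v)"
  shows "P xs"
  using assms(1)
proof (induction xs rule: length_induct)
  case (1 xs)
  show ?case
  proof (cases "xs = []")
    case True
    then show ?thesis using assms(2) by simp
  next
    case False
    obtain u m a v where d: "xs = u @ replicate m a @ v" "m > 0" "a \<notin> set (u @ v)"
      using noncrossing_interval_block[OF 1(2) False] by blast
    have "noncrossing_word (u @ v)" using noncrossing_remove_infix 1(2) d(1) by blast
    then show ?thesis using 1(1) d assms(3) by auto
  qed
qed

text \<open>
  Under this condition every block has at most two points, and a block of two points encloses an
  even number of points: it joins an odd to an even position.
\<close>

definition alternating :: "'a list \<Rightarrow> bool" where
  "alternating xs \<longleftrightarrow> (\<forall>i j. i < j \<and> j < length xs \<and> xs ! i = xs ! j \<longrightarrow> odd (j - i))"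

lemma alternating_remove_two:
  assumes "alternating (u @ x # y # v)"
  shows "alternating (u @ v)"
proof -
  define e where "e i = (if i < length u then i else i + 2)" for i
  have nth: "(u @ v) ! i = (u @ x # y # v) ! e i" for i
    by (simp add: e_def nth_append Suc_diff_le)
  show ?thesis
    unfolding alternating_def
  proof (intro allI impI, elim conjE)
    fix i j
    assume a: "i < j" "j < length (u @ v)" "(u @ v) ! i = (u @ v) ! j"
    have "e i < e j" "e j < length (u @ x # y # v)" using a by (auto simp: e_def)
    then have "odd (e j - e i)" using assms a nth unfolding alternating_def by metis
    then show "odd (j - i)" using a by (auto simp: e_def split: if_splits)
  qed
qed

text \<open>
  Consider two closest points of one block. The points between them are singletons, as noncrossing
  confines their blocks to this gap, where no block can have two points. Their number is even,
  so either it is zero and the two points are neighbours, or the first two singletons can be taken.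
  If there is no such block, all points are singletons.
\<close>

lemma alternating_adjacent:
  assumes "noncrossing_word xs" "alternating xs" "xs \<noteq> []" "even (length xs)"
  obtains u x y v where "xs = u @ x # y # v" "x \<notin> set (u @ v)" "y \<notin> set (u @ v)"
proof -
  note result = that
  have split: thesis if i: "Suc i < length xs"
    and sx: "\<And>q. q < length xs \<Longrightarrow> q \<noteq> i \<Longrightarrow> q \<noteq> Suc i \<Longrightarrow> xs ! q \<noteq> xs ! i \<and> xs ! q \<noteq> xs ! Suc i" for i
  proof -
    have dec: "xs = take i xs @ xs ! i # xs ! Suc i # drop (Suc (Suc i)) xs"
      using i by (metis Cons_nth_drop_Suc Suc_lessD append_take_drop_id)
    have "z \<notin> set (take i xs @ drop (Suc (Suc i)) xs)" if z: "z = xs ! i \<or> z = xs ! Suc i" for z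
    proof
      assume "z \<in> set (take i xs @ drop (Suc (Suc i)) xs)"
      then consider q where "q < i" "xs ! q = z"
        | q where "q < length xs - Suc (Suc i)" "xs ! (Suc (Suc i) + q) = z"
        using i by (auto simp: in_set_conv_nth)
      then show False
      proof cases
        case 1
        then show False using sx[of q] i z by auto
      next
        case 2
        then show False using sx[of "Suc (Suc i) + q"] i z by auto
      qed
    qed
    from result[OF dec this this] show thesis by simp
  qed
  show thesis
  proof (cases "distinct xs")
    case True
    have "Suc 0 < length xs" using assms(3,4) by (cases xs; cases "tl xs") auto
    moreover have "0 < length xs" using assms(3) by simp
    ultimately show thesis by (intro split[of 0]) (auto simp: nth_eq_iff_index_eq[OF True])
  next
    case False
    \<comment> \<open>\<open>Q d\<close> says that some block has two points at distance \<open>d\<close>; a least such \<open>d\<close> is chosen.\<close>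
    define Q where "Q d \<longleftrightarrow> (\<exists>i. 0 < d \<and> i + d < length xs \<and> xs ! i = xs ! (i + d))" for d
    have "\<exists>i j. i < j \<and> j < length xs \<and> xs ! i = xs ! j"
      using False unfolding distinct_conv_nth by (metis linorder_neqE_nat)
    then obtain i0 j0 where "i0 < j0" "j0 < length xs" "xs ! i0 = xs ! j0" by blast
    then have "Q (j0 - i0)" unfolding Q_def by (intro exI[of _ i0]) auto
    then have Ql: "Q (LEAST d. Q d)" by (rule LeastI)
    define d where "d = (LEAST d. Q d)"
    have minQ: "\<not> Q d'" if "d' < d" for d' using that not_less_Least unfolding d_def by blast
    obtain i where i: "0 < d" "i + d < length xs" "xs ! i = xs ! (i + d)"
      using Ql[folded d_def] unfolding Q_def by blast
    have odd: "odd (j' - i')" if "i' < j'" "j' < length xs" "xs ! i' = xs ! j'" for i' j'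
      using that assms(2) unfolding alternating_def by blast
    \<comment> \<open>A third point of this block would make one of three distances even.\<close>
    have two: "q = i \<or> q = i + d" if q: "q < length xs" "xs ! q = xs ! i" for q
    proof (rule ccontr)
      assume n: "\<not> (q = i \<or> q = i + d)"
      have od: "odd d" using odd[of i "i + d"] i by auto
      consider "q < i" | "i < q" "q < i + d" | "i + d < q" using n by linarith
      then show False
      proof cases
        case 1
        then have "odd (i - q)" "odd (i + d - q)" using odd[of q i] odd[of q "i+d"] i q by auto
        then show False using od 1 by (auto simp: algebra_simps)
      next
        case 2
        then have "odd (q - i)" "odd (i + d - q)" using odd[of i q] odd[of q "i+d"] i q by auto
        then show False using od 2 by (auto simp: algebra_simps)
      next
        case 3
        then have "odd (q - i)" "odd (q - (i + d))" using odd[of i q] odd[of "i+d" q] i q by auto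
        then show False using od 3 by (auto simp: algebra_simps)
      qed
    qed
    have single: "q = p" if p: "i < p" "p < i + d" and q: "q < length xs" "xs ! q = xs ! p" for p q
    proof (rule ccontr)
      assume n: "q \<noteq> p"
      have pi: "xs ! p \<noteq> xs ! i" using two[of p] p i by auto
      consider "q < i" | "q = i \<or> q = i + d" | "i < q" "q < i + d" | "i + d < q" using n by linarith
      then show False
      proof cases
        case 1
        then show False using noncrossing_wordD[OF assms(1), of q i p "i+d"] p q i pi by auto
      next
        case 2
        then show False using q pi i by auto
      next
        case 3
        define d' where "d' = (if p < q then q - p else p - q)"
        have "Q d'" unfolding Q_def d'_def
          by (rule exI[of _ "min p q"]) (use 3 p q n i in \<open>auto simp: min_def\<close>)
        moreover have "d' < d" using 3 p unfolding d'_def by auto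
        ultimately show False using minQ by blast
      next
        case 4
        then show False using noncrossing_wordD[OF assms(1), of i p "i+d" q] p q i pi by auto
      qed
    qed
    show thesis
    proof (cases "d = 1")
      case True
      show thesis by (rule split[of i]) (use i True two in auto)
    next
      case False
      have "odd d" using odd[of i "i + d"] i by auto
      then have d3: "d \<ge> 3" using False by presburger
      show thesis
      proof (rule split[of "Suc i"])
        show "Suc (Suc i) < length xs" using i d3 by auto
        fix q assume "q < length xs" "q \<noteq> Suc i" "q \<noteq> Suc (Suc i)"
        then show "xs ! q \<noteq> xs ! Suc i \<and> xs ! q \<noteq> xs ! Suc (Suc i)"
          using single[of "Suc i" q] single[of "Suc (Suc i)" q] d3 by auto
      qed
    qed
  qed
qed

section \<open>Families of words closed under the category operations\<close>

text \<open>
  The shapes of a globally colorized category have these closure properties. Words that differ by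
  an injective renaming of the labels stand for the same partition.
\<close>

locale shape_category =
  fixes V :: "nat list set"
  assumes relabel: "xs \<in> V \<Longrightarrow> inj_on f (set xs) \<Longrightarrow> map f xs \<in> V"
    and append: "xs \<in> V \<Longrightarrow> ys \<in> V \<Longrightarrow> set xs \<inter> set ys = {} \<Longrightarrow> xs @ ys \<in> V"
    and rotate: "xs @ ys \<in> V \<Longrightarrow> ys @ xs \<in> V"
    and cap: "xs @ a # b # ys \<in> V \<Longrightarrow> map (id(b := a)) (xs @ ys) \<in> V"
    and reverse: "xs \<in> V \<Longrightarrow> rev xs \<in> V"
    and pair: "[a, a] \<in> V"
    and even_length: "xs \<in> V \<Longrightarrow> even (length xs)"
begin

lemma empty_mem: "[] \<in> V"
  using cap[of "[]" 0 0 "[]"] pair by simp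

lemma insert:
  assumes "xs @ ys \<in> V" "zs \<in> V" "set zs \<inter> set (xs @ ys) = {}"
  shows "xs @ zs @ ys \<in> V"
proof -
  have "(ys @ xs) @ zs \<in> V"
    by (rule append[OF rotate[OF assms(1)] assms(2)]) (use assms(3) in auto)
  then show ?thesis using rotate[of ys "xs @ zs"] by simp
qed

lemma cap_unchanged:
  assumes "xs @ a # b # ys \<in> V" "a = b \<or> b \<notin> set (xs @ ys)"
  shows "xs @ ys \<in> V"
proof -
  have "map (id(b := a)) (xs @ ys) = xs @ ys"
    by (rule map_idI) (use assms(2) in auto)
  then show ?thesis using cap[OF assms(1)] by metis
qed

text \<open>
  Composing with a second word at one point: the point labelled \<open>a\<close> is replaced by the rest \<open>ws\<close> of a
  word \<open>a # ws\<close>. The second word is inserted behind \<open>a\<close> with its own copy of that label, and the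
  two neighbours are capped.
\<close>

lemma glue:
  assumes "xs @ a # ys \<in> V" "a # ws \<in> V" "set ws \<inter> set (xs @ a # ys) \<subseteq> {a}"
  shows "xs @ ws @ ys \<in> V"
proof -
  obtain b :: nat where b: "b \<notin> set (xs @ a # ys @ ws)"
    using ex_new_if_finite[OF infinite_UNIV_nat finite_set] by blast
  let ?f = "id(a := b)"
  have "inj_on ?f (set (a # ws))" using b by (auto simp: inj_on_def)
  then have prev: "map ?f (a # ws) \<in> V" by (rule relabel[OF assms(2)])
  have 1: "(xs @ [a]) @ (b # map ?f ws) @ ys \<in> V"
    by (rule insert) (use prev assms b in auto)
  have "map (id(b := a)) (xs @ map ?f ws @ ys) = xs @ ws @ ys"
  proof -
    have "map (id(b := a)) zs = zs" if "b \<notin> set zs" for zs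
      by (rule map_idI) (use that in auto)
    moreover have "map (id(b := a) \<circ> ?f) ws = ws"
      by (rule map_idI) (use b in auto)
    ultimately show ?thesis using b by simp
  qed
  then show ?thesis using cap[of xs a b "map ?f ws @ ys"] 1 by simp
qed

text \<open>
  The composition of a partition with its own reflection along \<open>v\<close>: append a reversed copy with fresh
  labels and cap \<open>v\<close> against its copy. This identifies exactly the labels in \<open>v\<close> with their
  copies.
\<close>

lemma double:
  assumes "u @ v \<in> V" and N: "\<And>c. c \<in> set (u @ v) \<Longrightarrow> c < N"
  shows "u @ rev (map (\<lambda>c. if c \<in> set v then c else c + N) u) \<in> V"
proof -
  define \<phi> where "\<phi> A c = (if c \<in> A then c else c + N)" for A c
  \<comment> \<open>The induction caps \<open>v\<close> from its right end; \<open>A\<close> collects the labels that have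
    already been identified with their copies.\<close>
  have step: "u @ rev (map (\<phi> (A \<union> set v)) u) \<in> V"
    if "u @ v @ rev (map (\<phi> A) v) @ rev (map (\<phi> A) u) \<in> V" "\<And>c. c \<in> set (u @ v) \<Longrightarrow> c < N"
    for A v
    using that
  proof (induction v arbitrary: A rule: rev_induct)
    case Nil
    then show ?case by simp
  next
    case (snoc c w)
    let ?f = "id(\<phi> A c := c)"
    have old: "map ?f zs = zs" if "set zs \<subseteq> set (u @ w)" for zs
      by (rule map_idI) (use that snoc.prems(2) in \<open>auto simp: \<phi>_def\<close>)
    have new: "map ?f (rev (map (\<phi> A) zs)) = rev (map (\<phi> (insert c A)) zs)" if "set zs \<subseteq> set (u @ w)" for zs
    proof -
      have "?f (\<phi> A d) = \<phi> (insert c A) d" if "d \<in> set zs" for d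
      proof -
        have "d < N" "c < N" using that \<open>set zs \<subseteq> set (u @ w)\<close> snoc.prems(2) by auto
        then show ?thesis by (auto simp: \<phi>_def)
      qed
      then show ?thesis by (simp add: rev_map)
    qed
    have "map ?f ((u @ w) @ rev (map (\<phi> A) w) @ rev (map (\<phi> A) u)) \<in> V"
      by (rule cap) (use snoc.prems(1) in simp)
    then have "u @ w @ rev (map (\<phi> (insert c A)) w) @ rev (map (\<phi> (insert c A)) u) \<in> V"
      using old[of u] old[of w] new[of w] new[of u] by (simp only: map_append append_assoc) simp
    from snoc.IH[OF this] show ?case using snoc.prems(2) by simp
  qed
  have "map (\<lambda>c. c + N) (rev (u @ v)) \<in> V"
    by (rule relabel[OF reverse[OF assms(1)]]) (simp add: inj_on_def)
  then have "(u @ v) @ map (\<lambda>c. c + N) (rev (u @ v)) \<in> V"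
    by (rule append[OF assms(1)]) (use N in fastforce)
  moreover have "\<phi> {} = (\<lambda>c. c + N)" by (simp add: \<phi>_def fun_eq_iff)
  ultimately have "u @ rev (map (\<phi> ({} \<union> set v)) u) \<in> V"
    by (intro step) (use N in \<open>simp_all add: rev_map\<close>)
  moreover have "\<phi> (set v) = (\<lambda>c. if c \<in> set v then c else c + N)" by (simp add: \<phi>_def fun_eq_iff)
  ultimately show ?thesis by simp
qed

lemma upper_bound: obtains N :: nat where "\<And>c. c \<in> set xs \<Longrightarrow> c < N"
  using finite_nat_set_iff_bounded[of "set xs"] by auto

text \<open>
  Capping inside \<open>w\<close> only merges labels of \<open>w\<close>, so only the parity of its length survives.
\<close>

lemma infix_reduce:
  assumes "x @ w @ y \<in> V" "set w \<inter> set (x @ y) = {}"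
  shows "if even (length w) then x @ y \<in> V else \<exists>s. s \<notin> set (x @ y) \<and> x @ [s] @ y \<in> V"
  using assms
proof (induction w rule: length_induct)
  case (1 w)
  consider "w = []" | s where "w = [s]" | c d w' where "w = c # d # w'"
    by (metis list.exhaust)
  then show ?case
  proof cases
    case (3 c d w')
    let ?f = "id(d := c)"
    have keep: "map ?f zs = zs" if "set zs \<subseteq> set (x @ y)" for zs
      by (rule map_idI) (use that 1(3) 3 in auto)
    have "map ?f (x @ w' @ y) \<in> V" by (rule cap) (use 1(2) 3 in simp)
    then have "x @ map ?f w' @ y \<in> V" using keep[of x] keep[of y] by simp
    moreover have "set (map ?f w') \<inter> set (x @ y) = {}" using 1(3) 3 by auto
    ultimately show ?thesis using 1(1)[rule_format, of "map ?f w'"] 3 by simp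
  qed (use 1 in auto)
qed

text \<open>
  Rotate such that the word has the form \<open>a w a q\<close> with \<open>a\<close> in \<open>q\<close>. Doubling along \<open>q\<close> gives
  \<open>a w a a w' a\<close>, with all four points \<open>a\<close> in one block as \<open>q\<close> connects them. After a
  rotation two points \<open>a\<close> are neighbours, and doubling along the rest leaves \<open>a a a a\<close>.
\<close>

lemma four_block_if_three_occurrences:
  assumes "xs \<in> V" "count_list xs a \<ge> 3"
  shows "[0, 0, 0, 0] \<in> V"
proof -
  have "a \<in> set xs" using assms(2) by (metis count_list_0_iff not_numeral_le_zero)
  then obtain p r where 1: "xs = p @ a # r" "a \<notin> set p" using split_list_first by metis
  then have "count_list r a \<ge> 2" using assms(2) by (simp add: count_list_0_iff)
  then have "a \<in> set r" by (metis count_list_0_iff not_numeral_le_zero)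
  then obtain w q where 2: "r = w @ a # q" "a \<notin> set w" using split_list_first by metis
  then have "count_list q a \<ge> 1"
    using \<open>count_list r a \<ge> 2\<close> by (simp add: count_list_0_iff)
  then have aq: "a \<in> set q" by (metis count_list_0_iff not_one_le_zero)
  have 3: "(a # w @ [a]) @ (q @ p) \<in> V"
    using rotate[of p "a # w @ a # q"] assms(1) 1 2 by simp
  obtain N where "\<And>c. c \<in> set ((a # w @ [a]) @ (q @ p)) \<Longrightarrow> c < N" using upper_bound by blast
  from double[OF 3 this] aq obtain w' where "a # w @ [a] @ [a] @ w' @ [a] \<in> V" by auto
  then have 4: "[a, a] @ (w @ [a, a] @ w') \<in> V"
    using rotate[of "a # w @ [a, a] @ w'" "[a]"] by simp
  obtain N where "\<And>c. c \<in> set ([a, a] @ (w @ [a, a] @ w')) \<Longrightarrow> c < N" using upper_bound by blast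
  from double[OF 4 this] have "[a, a, a, a] \<in> V" by simp
  from relabel[OF this, of "\<lambda>_. 0"] show ?thesis by simp
qed

lemma cap_replicate:
  assumes "u @ replicate (2 * n) a @ v \<in> V"
  shows "u @ v \<in> V"
  using assms
proof (induction n)
  case (Suc n)
  have "u @ a # a # replicate (2 * n) a @ v \<in> V" using Suc.prems by simp
  then have "u @ replicate (2 * n) a @ v \<in> V" by (rule cap_unchanged) simp
  then show ?case by (rule Suc.IH)
qed simp

lemma singletons_if_odd_parts:
  assumes "w @ v \<in> V" "odd (length w)" "set w \<inter> set v = {}"
  shows "[0, 1] \<in> V"
proof -
  have v: "odd (length v)" using even_length[OF assms(1)] assms(2) by simp
  obtain s where s: "s \<notin> set v" "[s] @ v @ [] \<in> V"
    using infix_reduce[of "[]" w v] assms by auto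
  then obtain t where t: "t \<noteq> s" "[s, t] \<in> V"
    using infix_reduce[of "[s]" v "[]"] v by auto
  have "map (\<lambda>c. if c = s then 0 else 1) [s, t] \<in> V"
    by (rule relabel[OF t(2)]) (use t(1) in \<open>auto simp: inj_on_def\<close>)
  then show ?thesis using t(1) by simp
qed

text \<open>
  Induction along the construction of noncrossing words by blocks on consecutive positions. Such a
  block of even size can be capped away; one of odd size, doubled along the rest of the word, gives
  two disjoint parts of odd length.
\<close>

lemma singletons_if_odd_block:
  assumes "noncrossing_word xs" "xs \<in> V" "odd (count_list xs b)"
  shows "[0, 1] \<in> V"
  using assms
proof (induction rule: noncrossing_induct)
  case (block u m a v)
  show ?case
  proof (cases "even m")
    case True
    then obtain n where n: "m = 2 * n" by blast
    have "u @ v \<in> V" by (rule cap_replicate[of u n a v]) (use block.prems n in simp)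
    moreover have "count_list (replicate m a) b = (if b = a then m else 0)" by (induction m) auto
    then have "odd (count_list (u @ v) b)" using block.prems(2) True by (auto split: if_splits)
    ultimately show ?thesis using block.IH by blast
  next
    case False
    have 1: "replicate m a @ (v @ u) \<in> V" using rotate[of u "replicate m a @ v"] block.prems(1) by simp
    obtain N where N: "\<And>c. c \<in> set (replicate m a @ v @ u) \<Longrightarrow> c < N" using upper_bound by blast
    have "a < N" using N block.hyps by simp
    from double[OF 1 N] block.hyps have "replicate m a @ replicate m (a + N) \<in> V" by simp
    then show ?thesis by (rule singletons_if_odd_parts) (use False \<open>a < N\<close> in auto)
  qed
qed simp

text \<open>
  Each of the two arcs into which the points \<open>a\<close> divide the circle reduces to one singleton.
\<close>

lemma lambda_if_odd_arcs:
  assumes "[a] @ w @ [a] @ v \<in> V" "odd (length w)" "odd (length v)"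
    and "set w \<inter> set v = {}" "a \<notin> set w" "a \<notin> set v"
  shows "[0, 1, 2, 1] \<in> V"
proof -
  obtain s where s: "s \<notin> set (a # v)" "[a] @ [s] @ (a # v) \<in> V"
    using infix_reduce[of "[a]" w "a # v"] assms by auto
  then have "[a, s, a] @ v @ [] \<in> V" by simp
  then obtain t where t: "t \<notin> {a, s}" "[a, s, a] @ [t] @ [] \<in> V"
    using infix_reduce[of "[a, s, a]" v "[]"] assms(3,6) s(1) by auto
  have mem: "[s, a, t, a] \<in> V" using t rotate[of "[a]" "[s, a, t]"] by simp
  have ne: "s \<noteq> a" "t \<noteq> a" "t \<noteq> s" using s(1) t(1) by auto
  have "map (\<lambda>c. if c = s then 0 else if c = a then 1 else 2) [s, a, t, a] \<in> V"
    by (rule relabel[OF mem]) (use ne in \<open>auto simp: inj_on_def\<close>)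
  then show ?thesis using ne by simp
qed

text \<open>
  Two points of one block at even distance enclose an odd number of points on both sides. Without
  \<open>[0, 0, 0, 0]\<close> this block has no other points, and noncrossing separates the labels of the
  two sides.
\<close>

lemma lambda_if_not_alternating:
  assumes "noncrossing_word xs" "xs \<in> V" "[0, 0, 0, 0] \<notin> V" "\<not> alternating xs"
  shows "[0, 1, 2, 1] \<in> V"
proof -
  obtain i j where ij: "i < j" "j < length xs" "xs ! i = xs ! j" "even (j - i)"
    using assms(4) unfolding alternating_def by blast
  define a where "a = xs ! i"
  define w where "w = take (j - Suc i) (drop (Suc i) xs)"
  define u where "u = take i xs"
  define v where "v = drop (Suc j) xs"
  have xs: "xs = u @ a # w @ a # v"
  proof -
    have "drop (Suc i) xs = w @ drop j xs"
      unfolding w_def using ij by (metis Suc_leI append_take_drop_id drop_drop le_add_diff_inverse2)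
    moreover have "drop j xs = a # v" unfolding a_def v_def using ij by (simp add: Cons_nth_drop_Suc)
    moreover have "xs = u @ a # drop (Suc i) xs"
      unfolding u_def a_def by (rule id_take_nth_drop) (use ij in simp)
    ultimately show ?thesis by simp
  qed
  have lw: "odd (length w)" unfolding w_def using ij by auto
  have lvu: "odd (length (v @ u))" using even_length[OF assms(2)] lw xs by simp
  have cnt: "count_list xs a \<le> 2"
    using four_block_if_three_occurrences[OF assms(2), of a] assms(3) by linarith
  then have "count_list w a = 0" "count_list u a = 0" "count_list v a = 0"
    unfolding xs count_list_append by simp_all
  then have a: "a \<notin> set w" "a \<notin> set u" "a \<notin> set v" by (simp_all only: count_list_0_iff not_False_eq_True)
  have disj: "set w \<inter> set (u @ v) = {}"
  proof (rule ccontr)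
    assume "set w \<inter> set (u @ v) \<noteq> {}"
    then obtain b where b: "b \<in> set w" "b \<in> set u \<or> b \<in> set v" by auto
    have lu: "length u = i" using ij unfolding u_def by simp
    have jl: "j = Suc i + length w" unfolding w_def using ij by auto
    obtain p where p: "p < length w" "w ! p = b" using b by (auto simp: in_set_conv_nth)
    have xp: "xs ! (Suc i + p) = b" unfolding xs using p lu by (simp add: nth_append)
    have "a \<noteq> b" using a b by auto
    from b(2) show False
    proof
      assume "b \<in> set u"
      then obtain q where q: "q < i" "u ! q = b" using lu by (auto simp: in_set_conv_nth)
      then have "xs ! q = b" unfolding xs using lu by (simp add: nth_append)
      then show False using noncrossing_wordD[OF assms(1), of q i "Suc i + p" j] q p jl ij xp \<open>a \<noteq> b\<close> a_def by auto
    next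
      assume "b \<in> set v"
      then obtain q where q: "q < length v" "v ! q = b" by (auto simp: in_set_conv_nth)
      have "xs ! (Suc j + q) = b" unfolding v_def using q ij by (simp add: v_def)
      moreover have "Suc j + q < length xs" using q(1) unfolding v_def by simp
      ultimately show False
        using noncrossing_wordD[OF assms(1), of i "Suc i + p" j "Suc j + q"] p jl ij xp \<open>a \<noteq> b\<close> a_def by auto
    qed
  qed
  have "[a] @ w @ [a] @ (v @ u) \<in> V" using rotate[of u "a # w @ a # v"] assms(2) xs by simp
  then show ?thesis by (rule lambda_if_odd_arcs) (use lw lvu disj a in auto)
qed

text \<open>
  A noncrossing word is obtained by successively inserting its blocks, each on consecutive positions.
\<close>

lemma mem_if_blocks_mem:
  assumes "noncrossing_word xs" "\<And>a. a \<in> set xs \<Longrightarrow> replicate (count_list xs a) a \<in> V"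
  shows "xs \<in> V"
  using assms
proof (induction rule: noncrossing_induct)
  case Nil
  show ?case by (rule empty_mem)
next
  case (block u m a v)
  have rep: "count_list (replicate m a) b = (if b = a then m else 0)" for b by (induction m) auto
  have ca: "count_list (u @ replicate m a @ v) a = m"
    using block.hyps rep by (simp add: count_list_0_iff)
  have "u @ v \<in> V"
  proof (rule block.IH)
    fix b assume b: "b \<in> set (u @ v)"
    then have "b \<noteq> a" using block.hyps by auto
    then have "count_list (u @ replicate m a @ v) b = count_list (u @ v) b" using rep by simp
    then show "replicate (count_list (u @ v) b) b \<in> V"
      using block.prems[of b] b by (simp only: set_append Un_iff) metis
  qed
  moreover have "replicate m a \<in> V" using block.prems[of a, unfolded ca] block.hyps by simp
  ultimately show ?case by (rule insert) (use block.hyps in auto)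
qed

lemma even_block_mem:
  assumes "[0, 0, 0, 0] \<in> V"
  shows "replicate (2 * n) a \<in> V"
proof (cases n)
  case 0
  then show ?thesis using empty_mem by simp
next
  case (Suc k)
  have q: "[a, a, a, a] \<in> V" using relabel[OF assms, of "\<lambda>_. a"] by simp
  have "replicate (2 * Suc k) a \<in> V"
  proof (induction k)
    case 0
    then show ?case using pair by (simp add: numeral_2_eq_2)
  next
    case (Suc k)
    have "[] @ a # replicate (Suc (2 * k)) a \<in> V" using Suc.IH by simp
    then have "[] @ [a, a, a] @ replicate (Suc (2 * k)) a \<in> V"
      by (rule glue) (use q in simp_all)
    then show ?case by simp
  qed
  then show ?thesis using Suc by simp
qed

lemma lambda_mem:
  fixes t y t' :: nat
  assumes "[0, 1, 2, 1] \<in> V" "distinct [t, y, t']"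
  shows "[t, y, t', y] \<in> V"
proof -
  have "map (\<lambda>c. if c = 0 then t else if c = 1 then y else t') [0, 1, 2, 1 :: nat] \<in> V"
    by (rule relabel[OF assms(1)]) (use assms(2) in \<open>auto simp: inj_on_def\<close>)
  then show ?thesis by simp
qed

lemma singletons_mem:
  fixes s t :: nat
  assumes "[0, 1] \<in> V" "s \<noteq> t"
  shows "[s, t] \<in> V"
proof -
  have "map (\<lambda>c. if c = 0 then s else t) [0, 1 :: nat] \<in> V"
    by (rule relabel[OF assms(1)]) (use assms(2) in \<open>auto simp: inj_on_def\<close>)
  then show ?thesis by simp
qed

text \<open>
  Glue singletons to the first and the third point of the block of size four.
\<close>

lemma lambda_if_four_block:
  assumes "[0, 0, 0, 0] \<in> V" "[0, 1] \<in> V"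
  shows "[0, 1, 2, 1] \<in> V"
proof -
  have q: "[1, 1, 1, 1] \<in> V" using relabel[OF assms(1), of "\<lambda>_. 1"] by simp
  have prev: "[] @ [0] @ [1, 1, 1] \<in> V"
    by (rule glue[of _ 1]) (use q singletons_mem[OF assms(2)] in auto)
  have "[0, 1] @ [2] @ [1] \<in> V"
    by (rule glue[of _ 1]) (use prev singletons_mem[OF assms(2)] in auto)
  then show ?thesis by simp
qed

text \<open>
  Gluing \<open>[t, y, t', y]\<close> to the point \<open>y\<close> surrounds it by two new singletons; the one facing \<open>s\<close> is
  capped with \<open>s\<close>, and the other one takes its place behind \<open>y\<close>.
\<close>

lemma singleton_commute_point:
  assumes "[0, 1, 2, 1] \<in> V" "xs @ s # y # ys \<in> V" "s \<notin> set (xs @ y # ys)"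
  shows "xs @ y # s # ys \<in> V"
proof -
  obtain t where t: "t \<notin> set (s # y # xs @ ys)"
    using ex_new_if_finite[OF infinite_UNIV_nat finite_set] by blast
  obtain t' where t': "t' \<notin> set (t # s # y # xs @ ys)"
    using ex_new_if_finite[OF infinite_UNIV_nat finite_set] by blast
  have "[t, y, t', y] \<in> V" by (rule lambda_mem[OF assms(1)]) (use t t' in auto)
  then have prev: "[y, t, y, t'] \<in> V" using rotate[of "[t, y, t']" "[y]"] by simp
  have prev: "(xs @ [s]) @ [t, y, t'] @ ys \<in> V"
    by (rule glue[of _ y]) (use prev assms t t' in auto)
  have "xs @ ([y, t'] @ ys) \<in> V"
    by (rule cap_unchanged[of xs s t]) (use prev assms t t' in auto)
  then have "map (id(t' := s)) (xs @ [y, t'] @ ys) \<in> V"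
    by (rule relabel) (use t' assms(3) in \<open>auto simp: inj_on_def\<close>)
  moreover have "map (id(t' := s)) zs = zs" if "t' \<notin> set zs" for zs
    by (rule map_idI) (use that in auto)
  then have "map (id(t' := s)) (xs @ [y, t'] @ ys) = xs @ y # s # ys" using t' by simp
  ultimately show ?thesis by simp
qed

lemma singleton_commute:
  assumes "[0, 1, 2, 1] \<in> V" "xs @ s # zs @ ys \<in> V" "s \<notin> set (xs @ zs @ ys)"
  shows "xs @ zs @ s # ys \<in> V"
  using assms(2,3)
proof (induction zs arbitrary: xs)
  case (Cons z zs)
  have "xs @ z # s # zs @ ys \<in> V"
    by (rule singleton_commute_point[OF assms(1)]) (use Cons.prems in auto)
  then show ?case using Cons.IH[of "xs @ [z]"] Cons.prems by simp
qed simp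

text \<open>
  An odd block on consecutive positions is created from a singleton by gluing, and a
  singleton can be moved to any position. Since a word of odd length is not in \<open>V\<close>, the induction
  carries it along with one additional singleton at the end. The expression
  \<open>2 * ((m + 1) div 2)\<close> rounds \<open>m\<close> up to an even number: a block of odd size \<open>m\<close> arises from gluing
  a block of size \<open>m + 1\<close> to a singleton.
\<close>

lemma mem_if_blocks_mem_singletons:
  assumes "noncrossing_word xs" "[0, 1, 2, 1] \<in> V" "[0, 1] \<in> V" "even (length xs)"
    and "\<And>a. a \<in> set xs \<Longrightarrow> replicate (2 * ((count_list xs a + 1) div 2)) a \<in> V"
  shows "xs \<in> V"
proof -
  have "(even (length xs) \<longrightarrow> xs \<in> V) \<and> (odd (length xs) \<longrightarrow> (\<forall>s. s \<notin> set xs \<longrightarrow> xs @ [s] \<in> V))"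
    using assms(1,5)
  proof (induction rule: noncrossing_induct)
    case Nil
    then show ?case using empty_mem by simp
  next
    case (block u m a v)
    have rep: "count_list (replicate m a) b = (if b = a then m else 0)" for b by (induction m) auto
    have ca: "count_list (u @ replicate m a @ v) a = m"
      using block.hyps rep by (simp add: count_list_0_iff)
    have IH: "even (length (u @ v)) \<Longrightarrow> u @ v \<in> V"
       "odd (length (u @ v)) \<Longrightarrow> s \<notin> set (u @ v) \<Longrightarrow> u @ v @ [s] \<in> V" for s
    proof -
      have "replicate (2 * ((count_list (u @ v) b + 1) div 2)) b \<in> V" if b: "b \<in> set (u @ v)" for b
      proof -
        have "b \<noteq> a" using b block.hyps by auto
        then have "count_list (u @ replicate m a @ v) b = count_list (u @ v) b" using rep by simp
        then show ?thesis using block.prems[of b] b by (simp only: set_append Un_iff) metis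
      qed
      from block.IH[OF this] show "even (length (u @ v)) \<Longrightarrow> u @ v \<in> V"
       "odd (length (u @ v)) \<Longrightarrow> s \<notin> set (u @ v) \<Longrightarrow> u @ v @ [s] \<in> V" by auto
    qed
    have m: "replicate (2 * ((m + 1) div 2)) a \<in> V" using block.prems[of a, unfolded ca] block.hyps by simp
    show ?case
    proof (cases "even m")
      case True
      then have prev: "replicate m a \<in> V" using m by simp
      have add: "u @ replicate m a @ ys \<in> V" if "u @ ys \<in> V" "a \<notin> set (u @ ys)" for ys
        by (rule insert) (use prev that in auto)
      show ?thesis
      proof (intro conjI impI allI)
        assume "even (length (u @ replicate m a @ v))"
        then show "u @ replicate m a @ v \<in> V" using True IH(1) add[of v] block.hyps by simp
      next
        fix s assume "odd (length (u @ replicate m a @ v))" and s: "s \<notin> set (u @ replicate m a @ v)"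
        then have "u @ v @ [s] \<in> V" using True IH(2)[of s] by simp
        then show "(u @ replicate m a @ v) @ [s] \<in> V"
          using add[of "v @ [s]"] block.hyps s by simp
      qed
    next
      case False
      then have am: "a # replicate m a \<in> V" using m by (simp flip: replicate_Suc)
      have grow: "u @ replicate m a @ ys \<in> V" if "u @ a # ys \<in> V" for ys
        by (rule glue[OF that am]) auto
      show ?thesis
      proof (intro conjI impI allI)
        assume "even (length (u @ replicate m a @ v))"
        then have "odd (length (u @ v))" using False by simp
        then have "u @ v @ [a] \<in> V" using IH(2)[of a] block.hyps by blast
        then have prev: "[] @ a # u @ v \<in> V" using rotate[of "u @ v" "[a]"] by simp
        have "[] @ u @ a # v \<in> V"
          by (rule singleton_commute[OF assms(2)]) (use prev block.hyps in auto)
        then show "u @ replicate m a @ v \<in> V" using grow by simp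
      next
        fix s assume "odd (length (u @ replicate m a @ v))" and s: "s \<notin> set (u @ replicate m a @ v)"
        then have uv: "u @ v \<in> V" using IH(1) False by simp
        have "s \<noteq> a" using s block.hyps by auto
        have "u @ [a, s] @ v \<in> V"
          by (rule insert[OF uv singletons_mem[OF assms(3)]])
            (use s \<open>s \<noteq> a\<close> block.hyps in auto)
        then have prev: "(u @ [a]) @ s # v @ [] \<in> V" by simp
        have "(u @ [a]) @ v @ s # [] \<in> V"
          by (rule singleton_commute[OF assms(2)]) (use prev s \<open>s \<noteq> a\<close> in auto)
        then show "(u @ replicate m a @ v) @ [s] \<in> V" using grow[of "v @ [s]"] by simp
      qed
    qed
  qed
  then show ?thesis using assms(4) by blast
qed

lemma alternating_mem:
  assumes "noncrossing_word xs" "alternating xs" "even (length xs)" "[0, 1] \<in> V"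
  shows "xs \<in> V"
  using assms(1-3)
proof (induction xs rule: length_induct)
  case (1 xs)
  show ?case
  proof (cases "xs = []")
    case True
    then show ?thesis using empty_mem by simp
  next
    case False
    then obtain u x y v where d: "xs = u @ x # y # v" "x \<notin> set (u @ v)" "y \<notin> set (u @ v)"
      by (rule alternating_adjacent[OF 1(2,3) _ 1(4)])
    have "noncrossing_word (u @ v)" using noncrossing_remove_infix[of u "[x, y]" v] 1(2) d by simp
    moreover have "alternating (u @ v)" by (rule alternating_remove_two[of u x y v]) (use 1(3) d in simp)
    ultimately have "u @ v \<in> V" using 1(1)[rule_format, of "u @ v"] 1(4) d(1) by simp
    moreover have "[x, y] \<in> V" using pair singletons_mem[OF assms(4)] by (cases "x = y") auto
    ultimately have "u @ [x, y] @ v \<in> V" by (rule insert) (use d in auto)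
    then show ?thesis using d by simp
  qed
qed

end

section \<open>Partitions given by labels\<close>

fun label :: "'a list \<Rightarrow> 'a list \<Rightarrow> point \<Rightarrow> 'a" where
  "label xs ys (Upper i) = xs ! i"
| "label xs ys (Lower j) = ys ! j"

text \<open>
  Blocks are the fibres of the labelling. Joining blocks and comparing partitions thus become
  computations with labels.
\<close>

definition labelled :: "color list \<Rightarrow> color list \<Rightarrow> 'a list \<Rightarrow> 'a list \<Rightarrow> partition" where
  "labelled us ls xs ys =
    Partition us ls
      ((\<lambda>p. {q \<in> points (length xs) (length ys). label xs ys q = label xs ys p}) `
        points (length xs) (length ys))"

lemma points_simps [simp]:
  "Upper i \<in> points k l \<longleftrightarrow> i < k"
  "Lower j \<in> points k l \<longleftrightarrow> j < l"
  by (auto simp: points_def)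

lemma labelled_cong:
  assumes "length xs' = length xs" "length ys' = length ys"
    and "\<And>p q. p \<in> points (length xs) (length ys) \<Longrightarrow> q \<in> points (length xs) (length ys) \<Longrightarrow>
      label xs ys q = label xs ys p \<longleftrightarrow> label xs' ys' q = label xs' ys' p"
  shows "labelled us ls xs ys = labelled us ls xs' ys'"
  unfolding labelled_def using assms by (auto intro!: image_cong)

lemma label_map:
  assumes "p \<in> points (length xs) (length ys)"
  shows "label (map f xs) (map f ys) p = f (label xs ys p)"
  using assms by (cases p) auto

lemma label_in_set:
  assumes "p \<in> points (length xs) (length ys)"
  shows "label xs ys p \<in> set xs \<union> set ys"
  using assms by (cases p) auto

lemma labelled_map:
  assumes "inj_on f (set xs \<union> set ys)"
  shows "labelled us ls (map f xs) (map f ys) = labelled us ls xs ys"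
proof (rule labelled_cong[symmetric])
  fix p q
  assume "p \<in> points (length xs) (length ys)" "q \<in> points (length xs) (length ys)"
  then show "label xs ys q = label xs ys p \<longleftrightarrow>
      label (map f xs) (map f ys) q = label (map f xs) (map f ys) p"
    using assms label_in_set by (metis inj_on_eq_iff label_map)
qed simp_all

lemma finite_points: "finite (points k l)"
  by (simp add: points_def)

text \<open>
  Number the blocks and label every point by the number of its block.
\<close>

lemma two_colored_labelled:
  assumes "p \<in> two_colored k l"
  obtains xs ys :: "nat list" where "length xs = k" "length ys = l"
    "p = labelled (upper_colors p) (lower_colors p) xs ys"
proof -
  have P: "partition_on (points k l) (blocks p)" using assms by (simp add: two_colored_def)
  then have "finite (blocks p)" using finite_elements[OF finite_points] by blast
  then obtain f :: "point set \<Rightarrow> nat" where f: "inj_on f (blocks p)"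
    using finite_imp_inj_to_nat_seg by blast
  define blk where "blk q = (THE B. B \<in> blocks p \<and> q \<in> B)" for q
  have blk_eq: "blk q = B" if "B \<in> blocks p" "q \<in> B" for q B
    unfolding blk_def
    by (rule the_equality) (use that partition_onD2[OF P] in \<open>auto simp: disjoint_def\<close>)
  have blk_in: "blk q \<in> blocks p \<and> q \<in> blk q" if "q \<in> points k l" for q
    using that partition_onD1[OF P] blk_eq by blast
  define xs where "xs = map (\<lambda>i. f (blk (Upper i))) [0..<k]"
  define ys where "ys = map (\<lambda>i. f (blk (Lower i))) [0..<l]"
  have len: "length xs = k" "length ys = l" by (simp_all add: xs_def ys_def)
  have lab: "label xs ys q = f (blk q)" if "q \<in> points k l" for q
    using that by (cases q) (simp_all add: xs_def ys_def)
  have cls: "{q \<in> points k l. label xs ys q = label xs ys r} = blk r" if r: "r \<in> points k l" for r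
  proof -
    have "label xs ys q = label xs ys r \<longleftrightarrow> q \<in> blk r" if q: "q \<in> points k l" for q
      using lab[OF q] lab[OF r] blk_in[OF q] blk_in[OF r] f blk_eq by (metis inj_on_eq_iff)
    moreover have "blk r \<subseteq> points k l" using blk_in[OF r] partition_onD1[OF P] by blast
    ultimately show ?thesis by blast
  qed
  have "blocks p = blk ` points k l"
  proof (intro set_eqI iffI)
    fix B assume B: "B \<in> blocks p"
    then obtain q where "q \<in> B" using partition_onD3[OF P] by (metis ex_in_conv)
    then show "B \<in> blk ` points k l" using B blk_eq partition_onD1[OF P] by blast
  qed (use blk_in in auto)
  also have "\<dots> = (\<lambda>r. {q \<in> points k l. label xs ys q = label xs ys r}) ` points k l"
    using cls by (intro image_cong) auto
  finally have "p = labelled (upper_colors p) (lower_colors p) xs ys"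
    unfolding labelled_def len by (cases p) simp
  then show thesis using that len by blast
qed

lemma label_append:
  assumes "p \<in> points (length xs) (length ys)"
  shows "label (xs @ xs') (ys @ ys') p = label xs ys p"
  using assms by (cases p) (auto simp: nth_append)

lemma label_shift:
  "label (xs @ xs') (ys @ ys') (shift (length xs) (length ys) q) = label xs' ys' q"
  by (cases q) auto

lemma points_add: "points (k + k') (l + l') = points k l \<union> shift k l ` points k' l'"
proof (intro set_eqI iffI)
  fix p assume p: "p \<in> points (k + k') (l + l')"
  show "p \<in> points k l \<union> shift k l ` points k' l'"
  proof (cases p)
    case (Upper i)
    show ?thesis
    proof (cases "i < k")
      case False
      then have "p = shift k l (Upper (i - k))" "Upper (i - k) \<in> points k' l'"
        using p Upper by auto
      then show ?thesis by blast
    qed (simp add: Upper)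
  next
    case (Lower j)
    show ?thesis
    proof (cases "j < l")
      case False
      then have "p = shift k l (Lower (j - l))" "Lower (j - l) \<in> points k' l'"
        using p Lower by auto
      then show ?thesis by blast
    qed (simp add: Lower)
  qed
qed (auto simp: points_def)

lemma tensor_labelled:
  assumes "length us = length xs" "length ls = length ys"
    and "(set xs \<union> set ys) \<inter> (set xs' \<union> set ys') = {}"
  shows "labelled us ls xs ys \<otimes> labelled us' ls' xs' ys' =
    labelled (us @ us') (ls @ ls') (xs @ xs') (ys @ ys')"
proof -
  let ?P = "points (length xs) (length ys)" and ?Q = "points (length xs') (length ys')"
  let ?s = "shift (length xs) (length ys)"
  let ?l = "label (xs @ xs') (ys @ ys')"
  have all: "points (length (xs @ xs')) (length (ys @ ys')) = ?P \<union> ?s ` ?Q"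
    by (simp add: points_add)
  have ne: "?l p \<noteq> ?l (?s q)" if "p \<in> ?P" "q \<in> ?Q" for p q
  proof -
    have "?l p \<in> set xs \<union> set ys"
      using label_append[OF that(1), of xs' ys'] label_in_set[OF that(1)] by metis
    moreover have "?l (?s q) \<in> set xs' \<union> set ys'"
      unfolding label_shift by (rule label_in_set[OF that(2)])
    ultimately show ?thesis using assms(3) by auto
  qed
  have left: "{q \<in> ?P \<union> ?s ` ?Q. ?l q = ?l p} = {q \<in> ?P. label xs ys q = label xs ys p}"
    if "p \<in> ?P" for p
    using that ne[OF that] label_append[where xs' = xs' and ys' = ys'] by (fastforce simp: eq_commute)
  have right: "{q \<in> ?P \<union> ?s ` ?Q. ?l q = ?l (?s p)} =
      ?s ` {q \<in> ?Q. label xs' ys' q = label xs' ys' p}" if "p \<in> ?Q" for p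
    using that ne[OF _ that] by (auto simp: label_shift)
  have "(\<lambda>p. {q \<in> ?P \<union> ?s ` ?Q. ?l q = ?l p}) ` (?P \<union> ?s ` ?Q) =
     (\<lambda>p. {q \<in> ?P. label xs ys q = label xs ys p}) ` ?P \<union>
     (`) ?s ` (\<lambda>p. {q \<in> ?Q. label xs' ys' q = label xs' ys' p}) ` ?Q"
    unfolding image_Un image_image using left right by (intro arg_cong2[where f = "(\<union>)"] image_cong) auto
  then show ?thesis
    unfolding tensor_def labelled_def all by (simp add: assms)
qed

lemma involution_labelled:
  "involution (labelled us ls xs ys) = labelled ls us ys xs"
proof -
  have lab: "label ys xs (reflect p) = label xs ys p" for p by (cases p) auto
  have rr: "reflect (reflect p) = p" for p by (cases p) auto
  have mem: "reflect p \<in> points l k \<longleftrightarrow> p \<in> points k l" for p k l by (cases p) auto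
  have img: "points (length ys) (length xs) = reflect ` points (length xs) (length ys)"
  proof (intro set_eqI iffI)
    fix p assume "p \<in> points (length ys) (length xs)"
    then have "reflect p \<in> points (length xs) (length ys)" using mem by simp
    then show "p \<in> reflect ` points (length xs) (length ys)" using rr[of p] by (metis image_eqI)
  qed (use mem in auto)
  have "reflect ` {q \<in> points (length xs) (length ys). label xs ys q = label xs ys p} =
    {q \<in> points (length ys) (length xs). label ys xs q = label ys xs (reflect p)}" for p
  proof (intro set_eqI iffI)
    fix q assume "q \<in> {q \<in> points (length ys) (length xs). label ys xs q = label ys xs (reflect p)}"
    then have "reflect q \<in> {q \<in> points (length xs) (length ys). label xs ys q = label xs ys p}"
      using mem[of q] lab[of "reflect q"] lab[of p] by (simp add: rr)
    then show "q \<in> reflect ` {q \<in> points (length xs) (length ys). label xs ys q = label xs ys p}"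
      by (rule image_eqI[rotated]) (simp add: rr)
  qed (auto simp: mem lab)
  then have "(`) reflect ` (\<lambda>p. {q \<in> points (length xs) (length ys). label xs ys q = label xs ys p}) `
      points (length xs) (length ys) =
    (\<lambda>p. {q \<in> points (length ys) (length xs). label ys xs q = label ys xs p}) `
      points (length ys) (length xs)"
    unfolding image_image img[symmetric] by (subst (2) img) (simp add: image_image)
  then show ?thesis
    unfolding involution_def labelled_def by simp
qed

lemma joined_on_top:
  assumes "u \<in> points (length xs) (length ys)" "v \<in> points (length xs) (length ys)"
    and "label xs ys u = label xs ys v"
  shows "(on_top u, on_top v) \<in> joined p (labelled us ls xs ys)"
proof -
  have "\<exists>B \<in> blocks (labelled us ls xs ys). u \<in> B \<and> v \<in> B"
    using assms unfolding labelled_def by auto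
  then show ?thesis unfolding joined_def by (intro r_into_rtrancl) blast
qed

lemma joined_at_bottom:
  assumes "u \<in> points (length xs) (length ys)" "v \<in> points (length xs) (length ys)"
    and "label xs ys u = label xs ys v"
  shows "(at_bottom u, at_bottom v) \<in> joined (labelled us ls xs ys) p"
proof -
  have "\<exists>B \<in> blocks (labelled us ls xs ys). u \<in> B \<and> v \<in> B"
    using assms unfolding labelled_def by auto
  then show ?thesis unfolding joined_def by (intro r_into_rtrancl) blast
qed

lemma sym_joined: "sym (joined p q)"
  unfolding joined_def by (rule sym_rtrancl) (auto simp: sym_def)

lemma blocks_labelledD:
  assumes "B \<in> blocks (labelled us ls xs ys)" "u \<in> B" "v \<in> B"
  shows "u \<in> points (length xs) (length ys)" "v \<in> points (length xs) (length ys)"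
    "label xs ys u = label xs ys v"
  using assms unfolding labelled_def by auto

text \<open>
  To identify a composition it suffices to give an invariant \<open>H\<close> of the points of the stacked diagram
  that is constant on the blocks of both parts and separates the resulting components.
\<close>

lemma composition_labelled:
  assumes "length us = length xs" "length ls = length ws"
    and top: "\<And>u v. u \<in> points (length xs) (length ms) \<Longrightarrow> v \<in> points (length xs) (length ms) \<Longrightarrow>
      label xs ms u = label xs ms v \<Longrightarrow> H (on_top u) = H (on_top v)"
    and bottom: "\<And>u v. u \<in> points (length ms') (length ws) \<Longrightarrow> v \<in> points (length ms') (length ws) \<Longrightarrow>
      label ms' ws u = label ms' ws v \<Longrightarrow> H (at_bottom u) = H (at_bottom v)"
    and complete: "\<And>u v. u \<in> points (length xs) (length ws) \<Longrightarrow> v \<in> points (length xs) (length ws) \<Longrightarrow>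
      H (Inl u) = H (Inl v) \<Longrightarrow>
      (Inl u, Inl v) \<in> joined (labelled cs' ls ms' ws) (labelled us cs xs ms)"
    and len: "length xs' = length xs" "length ws' = length ws"
    and lab: "\<And>u. u \<in> points (length xs) (length ws) \<Longrightarrow> label xs' ws' u = H (Inl u)"
  shows "composition (labelled cs' ls ms' ws) (labelled us cs xs ms) = labelled us ls xs' ws'"
proof -
  let ?J = "joined (labelled cs' ls ms' ws) (labelled us cs xs ms)"
  let ?P = "points (length xs) (length ws)"
  have sound: "H x = H y" if "(x, y) \<in> ?J" for x y
    using that unfolding joined_def
  proof (induction rule: rtrancl_induct)
    case (step y z)
    from step.hyps(2) have "H y = H z"
    proof (elim UnE UN_E)
      fix B assume B: "B \<in> blocks (labelled us cs xs ms)" "(y, z) \<in> on_top ` B \<times> on_top ` B"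
      then obtain u v where uv: "u \<in> B" "v \<in> B" and "y = on_top u" "z = on_top v" by blast
      then show ?thesis using top[OF blocks_labelledD[OF B(1) uv]] by (simp only:)
    next
      fix B assume B: "B \<in> blocks (labelled cs' ls ms' ws)" "(y, z) \<in> at_bottom ` B \<times> at_bottom ` B"
      then obtain u v where uv: "u \<in> B" "v \<in> B" and "y = at_bottom u" "z = at_bottom v" by blast
      then show ?thesis using bottom[OF blocks_labelledD[OF B(1) uv]] by (simp only:)
    qed
    then show ?case using step.IH by simp
  qed simp
  have inside: "x = y \<or> (x \<in> Inl ` ?P \<union> range Inr \<and> y \<in> Inl ` ?P \<union> range Inr)"
    if "(x, y) \<in> ?J" for x y
    using that unfolding joined_def
  proof (induction rule: rtrancl_induct)
    case (step y z)
    have on_top: "on_top u \<in> Inl ` ?P \<union> range Inr" if "u \<in> points (length xs) (length ms)" for u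
      using that by (cases u) auto
    have at_bottom: "at_bottom u \<in> Inl ` ?P \<union> range Inr"
      if "u \<in> points (length ms') (length ws)" for u
      using that by (cases u) auto
    from step.hyps(2) have "y \<in> Inl ` ?P \<union> range Inr \<and> z \<in> Inl ` ?P \<union> range Inr"
    proof (elim UnE UN_E)
      fix B assume B: "B \<in> blocks (labelled us cs xs ms)" "(y, z) \<in> on_top ` B \<times> on_top ` B"
      then obtain u v where uv: "u \<in> B" "v \<in> B" and "y = on_top u" "z = on_top v" by blast
      then show ?thesis using on_top[of u] on_top[of v] blocks_labelledD[OF B(1) uv] by (simp only:)
    next
      fix B assume B: "B \<in> blocks (labelled cs' ls ms' ws)" "(y, z) \<in> at_bottom ` B \<times> at_bottom ` B"
      then obtain u v where uv: "u \<in> B" "v \<in> B" and "y = at_bottom u" "z = at_bottom v" by blast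
      then show ?thesis using at_bottom[of u] at_bottom[of v] blocks_labelledD[OF B(1) uv] by (simp only:)
    qed
    then show ?case using step.IH by blast
  qed simp
  have cls: "{(x, y). (Inl x, Inl y) \<in> ?J} `` {u} = {v \<in> ?P. label xs' ws' v = label xs' ws' u}"
    if u: "u \<in> ?P" for u
  proof (intro set_eqI iffI)
    fix v assume "v \<in> {(x, y). (Inl x, Inl y) \<in> ?J} `` {u}"
    then have J: "(Inl u, Inl v) \<in> ?J" by simp
    then have "v \<in> ?P" using inside[OF J] u by auto
    then show "v \<in> {v \<in> ?P. label xs' ws' v = label xs' ws' u}" using sound[OF J] lab u by simp
  next
    fix v assume "v \<in> {v \<in> ?P. label xs' ws' v = label xs' ws' u}"
    then have v: "v \<in> ?P" and "H (Inl v) = H (Inl u)" using lab[of u] lab[of v] u by simp_all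
    then have "(Inl u, Inl v) \<in> ?J" by (intro complete[OF u v]) simp
    then show "v \<in> {(x, y). (Inl x, Inl y) \<in> ?J} `` {u}" by simp
  qed
  have "?P // {(x, y). (Inl x, Inl y) \<in> ?J} = (\<lambda>u. {v \<in> ?P. label xs' ws' v = label xs' ws' u}) ` ?P"
    unfolding quotient_def using cls by auto
  then show ?thesis
    unfolding composition_def by (simp add: labelled_def len assms(1,2))
qed

text \<open>
  The lower partition consists of identity strings and one cap over the middle points \<open>length ys\<close>
  and \<open>Suc (length ys)\<close>. These are labelled from left to right, the cap counting as one string.
  The effect on the upper partition is to merge the labels \<open>a\<close> and \<open>b\<close>.
\<close>

lemma composition_capping:
  fixes xs ys zs :: "nat list"
  defines "as \<equiv> [0..<length ys]" and "bs \<equiv> [Suc (length ys)..<Suc (length ys) + length zs]"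
  assumes "length us = length xs" "length cs = length ys" "length ds = length zs"
  shows "composition (labelled (cs @ c # c' # ds) (cs @ ds) (as @ length ys # length ys # bs) (as @ bs))
      (labelled us (cs @ c # c' # ds) xs (ys @ a # b # zs)) =
    labelled us (cs @ ds) (map (id(b := a)) xs) (map (id(b := a)) (ys @ zs))"
proof -
  let ?f = "id(b := a)"
  define n where "n = length ys"
  define ms where "ms = ys @ a # b # zs"
  let ?bot = "labelled (cs @ c # c' # ds) (cs @ ds) (as @ n # n # bs) (as @ bs)"
  let ?top = "labelled us (cs @ c # c' # ds) xs ms"
  let ?J = "joined ?bot ?top"
  define H where "H s = (case s of Inl (Upper i) \<Rightarrow> ?f (xs ! i) | Inl (Lower j) \<Rightarrow> ?f ((ys @ zs) ! j)
    | Inr j \<Rightarrow> ?f (ms ! j))" for s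
  have H_simps: "H (Inl (Upper i)) = ?f (xs ! i)" "H (Inl (Lower i)) = ?f ((ys @ zs) ! i)"
     "H (Inr i) = ?f (ms ! i)" for i
    by (simp_all add: H_def)
  have H_top: "H (on_top u) = ?f (label xs ms u)" for u
    by (cases u) (simp_all add: H_simps)
  \<comment> \<open>The merged label of a string of the lower partition, read off at its upper end.\<close>
  define g where "g l = (if l < n then ?f (ys ! l) else if l = n then a else ?f (zs ! (l - Suc n)))" for l
  have lab: "as ! i = i" if "i < n" for i using that by (simp add: as_def n_def)
  have lbs: "bs ! i = Suc (n + i)" if "i < length zs" for i using that by (simp add: bs_def n_def del: upt_Suc)
  have len: "length as = n" "length bs = length zs" by (simp_all add: as_def bs_def n_def del: upt_Suc)
  have nth_right: "(as @ zs') ! (n + i) = zs' ! i" "(ys @ zs'') ! (n + i) = zs'' ! i" for zs' zs'' i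
    using nth_append_length_plus[of as zs' i] nth_append_length_plus[of ys zs'' i]
    by (simp_all only: len n_def)
  have nth_mid: "(as @ z # zs') ! n = z" "(ys @ y # zs'') ! n = y" for z zs' y zs''
    using nth_right(1)[of "z # zs'" 0] nth_right(2)[of "y # zs''" 0] by simp_all
  have nth_left: "(as @ zs') ! i = i" "(ys @ zs'') ! i = ys ! i" if "i < n" for zs' zs'' i
    using that by (simp_all add: nth_append len lab n_def)
  have H_bot: "H (at_bottom u) = g (label (as @ n # n # bs) (as @ bs) u)"
    if u: "u \<in> points (length (as @ n # n # bs)) (length (as @ bs))" for u
  proof (cases u)
    case (Upper j)
    show ?thesis
    proof (cases "j < n")
      case True
      then show ?thesis by (simp add: Upper H_simps g_def nth_left ms_def)
    next
      case False
      then obtain k where k: "j = n + k" by (metis le_Suc_ex not_less)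
      have "k < Suc (Suc (length zs))" using u Upper k len by simp
      then consider "k = 0" | "k = Suc 0" | i where "k = Suc (Suc i)" "i < length zs"
        by (metis Suc_less_SucD not0_implies_Suc)
      then show ?thesis
        by cases (simp_all add: Upper k H_simps g_def ms_def nth_right nth_mid lbs del: add_Suc_right)
    qed
  next
    case (Lower j)
    show ?thesis
    proof (cases "j < n")
      case True
      then show ?thesis by (simp add: Lower H_simps g_def nth_left)
    next
      case False
      then obtain i where i: "j = n + i" by (metis le_Suc_ex not_less)
      moreover have "i < length zs" using u Lower i len by simp
      ultimately show ?thesis by (simp add: Lower H_simps g_def nth_right lbs)
    qed
  qed
  have symJ: "(x, y) \<in> ?J \<Longrightarrow> (y, x) \<in> ?J" for x y using sym_joined[unfolded sym_def] by blast
  have transJ: "(x, y) \<in> ?J \<Longrightarrow> (y, z) \<in> ?J \<Longrightarrow> (x, z) \<in> ?J" for x y z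
    unfolding joined_def by (rule rtrancl_trans)
  \<comment> \<open>The point of the upper partition to which a point of the composition is connected by
    an identity string.\<close>
  define t where "t u = (case u of Upper i \<Rightarrow> Upper i | Lower j \<Rightarrow> Lower (if j < n then j else j + 2))" for u
  have t: "t u \<in> points (length xs) (length ms) \<and> (Inl u, on_top (t u)) \<in> ?J \<and>
      ?f (label xs ms (t u)) = H (Inl u)" if u: "u \<in> points (length xs) (length (as @ bs))" for u
  proof (cases u)
    case (Upper i)
    then show ?thesis using u by (simp add: t_def H_simps joined_def)
  next
    case (Lower j)
    let ?i = "if j < n then j else j + 2"
    have j: "j < n + length zs" using u Lower len by simp
    have i: "?i < length ms" using j by (simp add: ms_def n_def[symmetric])
    have "(at_bottom (Lower j), at_bottom (Upper ?i)) \<in> ?J"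
      by (rule joined_at_bottom) (use j in \<open>auto simp: len nth_append lab lbs nth_Cons'\<close>)
    moreover have "ms ! ?i = (ys @ zs) ! j"
      by (auto simp: ms_def nth_append n_def[symmetric] nth_Cons')
    ultimately show ?thesis using i by (simp add: t_def Lower H_simps)
  qed
  \<comment> \<open>The two feet of the cap connect all points labelled \<open>a\<close> or \<open>b\<close>.\<close>
  have mid: "(Inr n, Inr (Suc n)) \<in> ?J"
    using joined_at_bottom[of "Upper n" "as @ n # n # bs" "as @ bs" "Upper (Suc n)"]
    by (simp add: len nth_append)
  have to_n: "(on_top u, Inr n) \<in> ?J"
    if u: "u \<in> points (length xs) (length ms)" "label xs ms u = a \<or> label xs ms u = b" for u
  proof -
    have n: "Lower n \<in> points (length xs) (length ms)" "Lower (Suc n) \<in> points (length xs) (length ms)"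
      by (simp_all add: ms_def n_def)
    have l: "label xs ms (Lower n) = a" "label xs ms (Lower (Suc n)) = b"
      by (simp_all add: ms_def n_def nth_append)
    from u(2) show ?thesis
    proof
      assume "label xs ms u = a"
      then show ?thesis using joined_on_top[OF u(1) n(1)] l by simp
    next
      assume "label xs ms u = b"
      then have "(on_top u, Inr (Suc n)) \<in> ?J" using joined_on_top[OF u(1) n(2)] l by simp
      then show ?thesis using symJ[OF mid] transJ by blast
    qed
  qed
  have top_complete: "(on_top u, on_top v) \<in> ?J"
    if u: "u \<in> points (length xs) (length ms)" and v: "v \<in> points (length xs) (length ms)"
      and eq: "?f (label xs ms u) = ?f (label xs ms v)" for u v
  proof (cases "label xs ms u = label xs ms v")
    case True
    then show ?thesis using joined_on_top u v by blast
  next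
    case False
    then have "label xs ms u = a \<or> label xs ms u = b" "label xs ms v = a \<or> label xs ms v = b"
      using eq by (auto split: if_splits)
    then show ?thesis using to_n[OF u] to_n[OF v] symJ transJ by blast
  qed
  have "composition ?bot ?top = labelled us (cs @ ds) (map ?f xs) (map ?f (ys @ zs))"
  proof (rule composition_labelled[where H = H])
    fix u v assume "u \<in> points (length xs) (length (as @ bs))" "v \<in> points (length xs) (length (as @ bs))"
      "H (Inl u) = H (Inl v)"
    then show "(Inl u, Inl v) \<in> ?J"
      using t[of u] t[of v] top_complete[of "t u" "t v"] symJ transJ by metis
  next
    fix u assume "u \<in> points (length xs) (length (as @ bs))"
    then show "label (map ?f xs) (map ?f (ys @ zs)) u = H (Inl u)"
      by (cases u) (auto simp: H_simps len n_def nth_append)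
  next
    show "length (cs @ ds) = length (as @ bs)"
      using assms(4,5) by (simp add: len n_def)
  next
    fix u v assume u: "u \<in> points (length (as @ n # n # bs)) (length (as @ bs))"
      and v: "v \<in> points (length (as @ n # n # bs)) (length (as @ bs))"
      and "label (as @ n # n # bs) (as @ bs) u = label (as @ n # n # bs) (as @ bs) v"
    then show "H (at_bottom u) = H (at_bottom v)" unfolding H_bot[OF u] H_bot[OF v] by simp
  next
    show "length (map ?f (ys @ zs)) = length (as @ bs)" by (simp add: len n_def)
  qed (simp_all add: assms(3) H_top)
  then show ?thesis unfolding ms_def n_def .
qed

section \<open>Words of a category\<close>

fun inverse_color :: "color \<Rightarrow> color" where
  "inverse_color White = Black"
| "inverse_color Black = White"

lemma inverse_color_inverse_color [simp]: "inverse_color (inverse_color c) = c"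
  by (cases c) simp_all

abbreviation word :: "color list \<Rightarrow> nat list \<Rightarrow> partition" where
  "word cs xs \<equiv> labelled [] cs [] xs"

lemma fresh_nat: obtains e :: nat where "e \<notin> set xs"
  using ex_new_if_finite[OF infinite_UNIV_nat finite_set] by blast

lemma points_11: "points (Suc 0) (Suc 0) = {Upper 0, Lower 0}"
  by (auto simp: points_def)

lemma points_0: "points 0 n = Lower ` {..<n}"
  by (auto simp: points_def)

lemma id_part_labelled: "id_part c = labelled [c] [c] [x] [x]"
  by (auto simp: id_part_def labelled_def points_11)

lemma lower_block_labelled: "lower_block cs = word cs (replicate (length cs) x)"
proof -
  have "{q \<in> points 0 (length cs). label [] (replicate (length cs) x) q = label [] (replicate (length cs) x) p} =
      Lower ` {..<length cs}" if "p \<in> points 0 (length cs)" for p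
    using that by (auto simp: points_0)
  then have "(\<lambda>p. {q \<in> points 0 (length cs). label [] (replicate (length cs) x) q = label [] (replicate (length cs) x) p}) `
      points 0 (length cs) = (if cs = [] then {} else {Lower ` {..<length cs}})"
    by (auto simp: points_0 image_iff)
  then show ?thesis unfolding lower_block_def labelled_def by simp
qed

lemma pair_part_labelled: "\<pi> c d = word [c, d] [x, x]"
  unfolding pair_part_def lower_block_labelled[of _ x] by simp

lemma four_block_labelled: "\<beta> c d e f = word [c, d, e, f] [x, x, x, x]"
  unfolding four_block_def lower_block_labelled[of _ x] by simp

lemma singleton_part_labelled: "\<sigma> c = word [c] [x]"
  unfolding singleton_part_def lower_block_labelled[of _ x] by simp

lemma white_block_labelled: "white_block s = word (replicate s White) (replicate s x)"
  unfolding white_block_def lower_block_labelled[of _ x] by simp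

lemma lambda1_labelled: "lambda1 = word [White, White, Black, Black] [0, 1, 2, 1]"
proof -
  have P: "points 0 (Suc (Suc (Suc (Suc 0)))) = {Lower 0, Lower 1, Lower 2, Lower 3}"
    by (simp add: points_0 lessThan_Suc numeral_eq_Suc insert_commute)
  let ?l = "label [] [0, 1, 2, 1 :: nat]"
  let ?c = "\<lambda>p. {q \<in> {Lower 0, Lower 1, Lower 2, Lower 3}. ?l q = ?l p}"
  have "?c (Lower 0) = {Lower 0}" "?c (Lower 1) = {Lower 1, Lower 3}"
    "?c (Lower 2) = {Lower 2}" "?c (Lower 3) = {Lower 1, Lower 3}"
    by (auto simp: numeral_3_eq_3 numeral_2_eq_2)
  then have "?c ` {Lower 0, Lower 1, Lower 2, Lower 3} = {{Lower 0}, {Lower 1, Lower 3}, {Lower 2}}"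
    by (simp only: image_insert image_empty) blast
  then show ?thesis unfolding lambda1_def labelled_def by (simp only: list.size P add_0_right add_Suc_right)
qed

lemma empty_partition_labelled: "empty_partition = word [] []"
  by (simp add: empty_partition_def labelled_def points_def)

lemma word_map:
  assumes "inj_on f (set xs)"
  shows "word cs (map f xs) = word cs xs"
  using labelled_map[of f "[]" xs "[]" cs] assms by simp

locale two_colored_category =
  fixes C :: "partition set"
  assumes category: "category C"
begin

lemma tensor_mem: "p \<in> C \<Longrightarrow> q \<in> C \<Longrightarrow> p \<otimes> q \<in> C"
  and composition_mem: "p \<in> C \<Longrightarrow> q \<in> C \<Longrightarrow> composable p q \<Longrightarrow> composition p q \<in> C"
  and involution_mem: "p \<in> C \<Longrightarrow> involution p \<in> C"
  using category unfolding category_def by blast+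

lemma id_mem: "labelled [c] [c] [x] [x] \<in> C"
  using category unfolding category_def id_part_labelled[of _ x] by (cases c) auto

lemma pair_mem: "word [c, inverse_color c] [x, x] \<in> C"
  using category unfolding category_def pair_part_labelled[of _ _ x] by (cases c) auto

lemma labelled_append_mem:
  assumes "labelled us ls xs ys \<in> C" "labelled us' ls' xs' ys' \<in> C"
    and "length us = length xs" "length ls = length ys"
    and "(set xs \<union> set ys) \<inter> (set xs' \<union> set ys') = {}"
  shows "labelled (us @ us') (ls @ ls') (xs @ xs') (ys @ ys') \<in> C"
  using tensor_mem[OF assms(1,2)] tensor_labelled[OF assms(3-5)] by metis

text \<open>
  This is the tensor product of identity strings with the reflection of a pair partition.
\<close>

lemma capping_mem:
  fixes as bs :: "nat list"
  assumes "distinct (as @ e # bs)" "length cs = length as" "length ds = length bs"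
  shows "labelled (cs @ c # inverse_color c # ds) (cs @ ds) (as @ e # e # bs) (as @ bs) \<in> C"
proof -
  have right: "labelled (c # inverse_color c # ds) ds (e # e # bs) bs \<in> C"
    using assms(1,3)
  proof (induction bs arbitrary: ds rule: rev_induct)
    case Nil
    then show ?case
      using involution_mem[OF pair_mem[of c e]] by (simp add: involution_labelled)
  next
    case (snoc b bs)
    then obtain d ds' where ds: "ds = ds' @ [d]" "length ds' = length bs"
      by (cases ds rule: rev_cases) auto
    have "labelled (c # inverse_color c # ds') ds' (e # e # bs) bs \<in> C"
      by (rule snoc.IH) (use snoc.prems ds in auto)
    from labelled_append_mem[OF this id_mem[of d b]] show ?case using ds snoc.prems by simp
  qed
  show ?thesis
    using assms(1,2)
  proof (induction as arbitrary: cs)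
    case Nil
    then show ?case using right by simp
  next
    case (Cons a as)
    then obtain c' cs' where cs: "cs = c' # cs'" "length cs' = length as"
      by (cases cs) auto
    have "labelled (cs' @ c # inverse_color c # ds) (cs' @ ds) (as @ e # e # bs) (as @ bs) \<in> C"
      by (rule Cons.IH) (use Cons.prems cs in auto)
    from labelled_append_mem[OF id_mem[of c' a] this] show ?case using cs Cons.prems by simp
  qed
qed

lemma cap_mem:
  fixes xs ys zs :: "nat list"
  assumes "labelled us (cs @ c # inverse_color c # ds) xs (ys @ a # b # zs) \<in> C"
    and "length us = length xs" "length cs = length ys" "length ds = length zs"
  shows "labelled us (cs @ ds) (map (id(b := a)) xs) (map (id(b := a)) (ys @ zs)) \<in> C"
  unfolding composition_capping[OF assms(2-4), symmetric, where c = c and c' = "inverse_color c"]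
  by (rule composition_mem[OF capping_mem assms(1)])
    (use assms(3,4) in \<open>auto simp: composable_def labelled_def simp del: upt_Suc\<close>)

lemma word_cap:
  assumes "word (cs @ c # inverse_color c # ds) (ys @ a # b # zs) \<in> C"
    and "length cs = length ys" "length ds = length zs"
  shows "word (cs @ ds) (map (id(b := a)) (ys @ zs)) \<in> C"
  using cap_mem[OF assms(1)] assms(2,3) by simp

text \<open>
  Put an identity string on the left and cap its lower end with the first lower point.
\<close>

lemma Lower_to_Upper:
  fixes xs ys :: "nat list"
  assumes "labelled us (inverse_color c # ls) xs (x # ys) \<in> C"
    and "length us = length xs" "length ls = length ys"
  shows "labelled (c # us) ls (x # xs) ys \<in> C"
proof -
  obtain e where e: "e \<notin> set (x # xs @ ys)" by (rule fresh_nat)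
  have "labelled ([c] @ us) ([c] @ inverse_color c # ls) ([e] @ xs) ([e] @ x # ys) \<in> C"
    by (rule labelled_append_mem[OF id_mem assms(1)]) (use e in auto)
  then have "labelled (c # us) ([] @ c # inverse_color c # ls) (e # xs) ([] @ e # x # ys) \<in> C" by simp
  from cap_mem[OF this] assms(2,3)
  have "labelled (c # us) ls (map (id(x := e)) (e # xs)) (map (id(x := e)) ys) \<in> C" by simp
  moreover have "map (id(x := e)) (e # xs) = map (id(x := e)) (x # xs)" using e by simp
  moreover have "inj_on (id(x := e)) (set (x # xs) \<union> set ys)" using e by (auto simp: inj_on_def)
  ultimately show ?thesis using labelled_map[of "id(x := e)" "x # xs" ys "c # us" ls] by metis
qed

text \<open>
  This is the reflection of the preceding statement.
\<close>

lemma Upper_to_Lower: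
  fixes xs ys :: "nat list"
  assumes "labelled (c # us) ls (x # xs) ys \<in> C"
    and "length us = length xs" "length ls = length ys"
  shows "labelled us (inverse_color c # ls) xs (x # ys) \<in> C"
proof -
  have "labelled ls (inverse_color (inverse_color c) # us) ys (x # xs) \<in> C"
    using involution_mem[OF assms(1)] by (simp add: involution_labelled)
  from involution_mem[OF Lower_to_Upper[OF this assms(3,2)]] show ?thesis
    by (simp add: involution_labelled)
qed

text \<open>
  The upper points are bent down on the left one after the other, which reverses their order and
  inverts their colors.
\<close>

lemma labelled_mem_iff_word_mem:
  assumes "length us = length xs" "length ls = length ys"
  shows "labelled us ls xs ys \<in> C \<longleftrightarrow>
    word (rev (map inverse_color us) @ ls) (rev xs @ ys) \<in> C"
  using assms
proof (induction us arbitrary: ls xs ys)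
  case (Cons c us)
  then obtain x xs' where xs: "xs = x # xs'" "length us = length xs'" by (cases xs) auto
  have "labelled (c # us) ls (x # xs') ys \<in> C \<longleftrightarrow>
      labelled us (inverse_color c # ls) xs' (x # ys) \<in> C"
    using Upper_to_Lower Lower_to_Upper xs Cons.prems by metis
  then show ?case using Cons.IH[of xs' "inverse_color c # ls" "x # ys"] xs Cons.prems by simp
qed simp

lemma word_reverse:
  assumes "word cs xs \<in> C" "length cs = length xs"
  shows "word (rev (map inverse_color cs)) (rev xs) \<in> C"
  using involution_mem[OF assms(1)] labelled_mem_iff_word_mem[of cs xs "[]" "[]"] assms(2)
  by (simp add: involution_labelled)

lemma word_append:
  assumes "word cs xs \<in> C" "word ds ys \<in> C" "length cs = length xs" "set xs \<inter> set ys = {}"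
  shows "word (cs @ ds) (xs @ ys) \<in> C"
  using labelled_append_mem[OF assms(1,2)] assms(3,4) by simp

text \<open>
  Cap the last point with an identity string on the right, which bends it to the upper row, and then
  bend it down on the left.
\<close>

lemma word_rotate1:
  assumes "word (cs @ [c]) (xs @ [a]) \<in> C" "length cs = length xs"
  shows "word (c # cs) (a # xs) \<in> C"
proof -
  obtain e where e: "e \<notin> set (a # xs)" by (rule fresh_nat)
  have "labelled ([] @ [inverse_color c]) ((cs @ [c]) @ [inverse_color c]) ([] @ [e]) ((xs @ [a]) @ [e]) \<in> C"
    by (rule labelled_append_mem[OF assms(1) id_mem]) (use e assms(2) in auto)
  then have "labelled [inverse_color c] (cs @ c # inverse_color c # []) [e] (xs @ a # e # []) \<in> C" by simp
  from cap_mem[OF this] assms(2)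
  have "labelled [inverse_color c] cs [a] (map (id(e := a)) xs) \<in> C" by simp
  moreover have "map (id(e := a)) xs = xs" by (rule map_idI) (use e in auto)
  ultimately have "labelled [inverse_color c] cs [a] xs \<in> C" by simp
  from Upper_to_Lower[OF this] assms(2) show ?thesis by simp
qed

lemma word_rotate:
  assumes "word (cs @ ds) (xs @ ys) \<in> C" "length cs = length xs" "length ds = length ys"
  shows "word (ds @ cs) (ys @ xs) \<in> C"
  using assms
proof (induction ys arbitrary: ds cs xs rule: rev_induct)
  case (snoc y ys)
  then obtain d ds' where ds: "ds = ds' @ [d]" "length ds' = length ys"
    by (cases ds rule: rev_cases) auto
  have "word (d # cs @ ds') (y # xs @ ys) \<in> C"
    by (rule word_rotate1) (use snoc.prems ds in auto)
  then have "word (ds' @ d # cs) (ys @ y # xs) \<in> C"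
    using snoc.IH[of "d # cs" ds' "y # xs"] snoc.prems ds by simp
  then show ?case using ds by simp
qed simp

lemma empty_mem: "word [] [] \<in> C"
  using word_cap[of "[]" White "[]" "[]" 0 0 "[]"] pair_mem[of White 0] by simp

end

section \<open>Permuting colors\<close>

primrec color_value :: "color \<Rightarrow> int" where
  "color_value White = 1"
| "color_value Black = -1"

definition color_sum :: "color list \<Rightarrow> int" where
  "color_sum cs = (\<Sum>c\<leftarrow>cs. color_value c)"

lemma color_sum_simps [simp]:
  "color_sum [] = 0"
  "color_sum (c # cs) = color_value c + color_sum cs"
  "color_sum (cs @ ds) = color_sum cs + color_sum ds"
  "color_sum (rev cs) = color_sum cs"
  "color_sum (map inverse_color cs) = - color_sum cs"
  "color_sum (replicate n c) = int n * color_value c"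
proof -
  have inv: "color_value (inverse_color c) = - color_value c" for c by (cases c) simp_all
  show "color_sum (map inverse_color cs) = - color_sum cs"
    by (induction cs) (simp_all add: color_sum_def inv)
  show "color_sum (replicate n c) = int n * color_value c"
    by (simp add: color_sum_def map_replicate_const sum_list_replicate)
qed (simp_all add: color_sum_def flip: rev_map)

lemma color_sum_inverse [simp]: "color_value (inverse_color c) = - color_value c"
  by (cases c) simp_all

lemma even_color_sum_iff: "even (color_sum cs) \<longleftrightarrow> even (length cs)"
proof (induction cs)
  case (Cons c cs)
  then show ?case by (cases c) auto
qed simp

lemma count_color:
  "2 * int (count (mset cs) c) = int (length cs) + color_value c * color_sum cs"
proof (induction cs)
  case (Cons d cs)
  then show ?case by (cases c; cases d) (auto simp: algebra_simps)
qed simp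

text \<open>
  The length and the color sum together determine the numbers of white and of black points.
\<close>

lemma mset_eq_if_color_sum_eq:
  assumes "length cs = length ds" "color_sum cs = color_sum ds"
  shows "mset cs = mset ds"
proof (rule multiset_eqI)
  fix c
  show "count (mset cs) c = count (mset ds) c"
    using count_color[of cs c] count_color[of ds c] assms by simp
qed

locale globally_colorized_category = two_colored_category +
  assumes globally: "globally_colorized C"
begin

text \<open>
  The rotation \<open>s t t s\<close> of \<open>\<pi> White White \<otimes> \<pi> Black Black\<close> is attached with its first two points
  to the last two points \<open>a b\<close> in reversed order. Its last two points continue the strings of \<open>a\<close> and
  \<open>b\<close>, with the colors exchanged.
\<close>

lemma word_swap_end:
  assumes "word (cs @ [c, inverse_color c]) (xs @ [a, b]) \<in> C" "length cs = length xs"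
  shows "word (cs @ [inverse_color c, c]) (xs @ [a, b]) \<in> C"
proof -
  let ?d = "inverse_color c"
  obtain s where s: "s \<notin> set (a # b # xs)" by (rule fresh_nat)
  obtain t where t: "t \<notin> set (s # a # b # xs)" by (rule fresh_nat)
  have pp: "word [White, White, Black, Black] [x, x, y, y] \<in> C" if "x \<noteq> y" for x y
  proof -
    have "word [White, White] [x, x] \<otimes> word [Black, Black] [y, y] =
        word [White, White, Black, Black] [x, x, y, y]"
      using tensor_labelled[of "[]" "[]" "[White, White]" "[x, x]" "[]" "[y, y]" "[]" "[Black, Black]"]
        that by simp
    then show ?thesis
      using globally unfolding globally_colorized_def pair_part_labelled[of White _ x]
        pair_part_labelled[of Black _ y] by simp
  qed
  have "word [c, ?d, ?d, c] [s, t, t, s] \<in> C"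
  proof (cases c)
    case White
    then show ?thesis
      using word_rotate[of "[White]" "[White, Black, Black]" "[s]" "[s, t, t]"] pp[of s t] s t by auto
  next
    case Black
    then show ?thesis
      using word_rotate[of "[White, White, Black]" "[Black]" "[t, t, s]" "[s]"] pp[of t s] s t by auto
  qed
  then have "word ((cs @ [c, ?d]) @ [c, ?d, ?d, c]) ((xs @ [a, b]) @ [s, t, t, s]) \<in> C"
    by (intro word_append[OF assms(1)]) (use assms(2) s t in auto)
  then have "word ((cs @ [c]) @ ?d # inverse_color ?d # [?d, ?d, c]) ((xs @ [a]) @ b # s # [t, t, s]) \<in> C"
    by simp
  from word_cap[OF this] assms(2)
  have "word (cs @ [c, ?d, ?d, c]) (map (id(s := b)) (xs @ [a, t, t, s])) \<in> C" by simp
  moreover have "map (id(s := b)) (xs @ [a, t, t, s]) = xs @ [a, t, t, b]"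
    using s t by (auto intro: map_idI)
  ultimately have "word (cs @ c # ?d # [?d, c]) (xs @ a # t # [t, b]) \<in> C" by simp
  from word_cap[OF this] assms(2)
  have "word (cs @ [?d, c]) (map (id(t := a)) (xs @ [t, b])) \<in> C" by simp
  moreover have "map (id(t := a)) (xs @ [t, b]) = xs @ [a, b]"
    using t by (auto intro: map_idI)
  ultimately show ?thesis by simp
qed

lemma word_swap:
  assumes "word (cs @ c # d # ds) xs \<in> C" "length xs = length (cs @ c # d # ds)"
  shows "word (cs @ d # c # ds) xs \<in> C"
proof (cases "c = d")
  case False
  then have d: "d = inverse_color c" by (cases c; cases d) simp_all
  define ys where "ys = take (length cs) xs"
  obtain a b zs where zs: "drop (length cs) xs = a # b # zs" "length zs = length ds"
    using assms(2) by (cases "drop (length cs) xs" rule: remdups_adj.cases)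
      (auto dest!: arg_cong[where f = length])
  have xs: "xs = ys @ a # b # zs" unfolding ys_def zs(1)[symmetric] by simp
  have len: "length cs = length ys" unfolding ys_def using assms(2) by simp
  have "word (ds @ cs @ [c, d]) (zs @ ys @ [a, b]) \<in> C"
    using word_rotate[of "cs @ [c, d]" ds "ys @ [a, b]" zs] assms(1) xs zs(2) len by simp
  then have "word (ds @ cs @ [d, c]) (zs @ ys @ [a, b]) \<in> C"
    using word_swap_end[of "ds @ cs" c "zs @ ys" a b] d len zs(2) by simp
  then show ?thesis
    using word_rotate[of ds "cs @ [d, c]" zs "ys @ [a, b]"] xs zs(2) len by simp
qed (use assms in simp)

text \<open>
  Adjacent exchanges generate all permutations of the colors; the labels stay in place.
\<close>

lemma word_mset:
  assumes "word cs xs \<in> C" "length xs = length cs" "mset cs = mset ds"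
  shows "word ds xs \<in> C"
proof -
  \<comment> \<open>The required first color is moved to the front.\<close>
  have bubble: "word (pre @ d # u @ v) xs \<in> C" if "word (pre @ u @ d # v) xs \<in> C"
    "length xs = length (pre @ u @ d # v)" for pre u d v
    using that
  proof (induction u arbitrary: v rule: rev_induct)
    case (snoc c u)
    have "word ((pre @ u) @ d # c # v) xs \<in> C"
      by (rule word_swap) (use snoc.prems in simp_all)
    then show ?case using snoc.IH[of "c # v"] snoc.prems by simp
  qed simp
  have "word (pre @ ds) xs \<in> C" if "word (pre @ cs) xs \<in> C" "length xs = length (pre @ cs)"
    "mset cs = mset ds" for pre cs
    using that
  proof (induction ds arbitrary: pre cs)
    case (Cons d ds)
    have "d \<in> set cs" using Cons.prems(3) by (metis list.set_intros(1) set_mset_mset)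
    then obtain u v where cs: "cs = u @ d # v" by (meson split_list)
    have "word ((pre @ [d]) @ u @ v) xs \<in> C" using bubble[of pre u d v] Cons.prems cs by simp
    then show ?case using Cons.IH[of "pre @ [d]" "u @ v"] Cons.prems cs by simp
  qed simp
  from this[of "[]"] assms show ?thesis by simp
qed

lemma word_recolor:
  assumes "word cs xs \<in> C" "length cs = length xs" "length ds = length xs"
    and "color_sum cs = color_sum ds"
  shows "word ds xs \<in> C"
  using word_mset[OF assms(1)] mset_eq_if_color_sum_eq[of cs ds] assms(2-4) by simp

end

section \<open>Shapes and color sums\<close>

text \<open>
  Color sum 0 ensures that two neighbouring points can always be given inverse colors, so that shapes
  are closed under unrestricted capping. For words of another color sum this fails: a word
  consisting only of white points offers nothing to cap.
\<close>

definition shapes :: "partition set \<Rightarrow> nat list set" where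
  "shapes C = {xs. \<exists>cs. length cs = length xs \<and> color_sum cs = 0 \<and> word cs xs \<in> C}"

definition sums :: "partition set \<Rightarrow> int set" where
  "sums C = {s. \<exists>cs xs. length cs = length xs \<and> color_sum cs = s \<and> word cs xs \<in> C}"

context two_colored_category
begin

lemma word_fresh_copy:
  assumes "word cs xs \<in> C" "finite A"
  obtains ys where "length ys = length xs" "word cs ys \<in> C" "set ys \<inter> A = {}"
proof -
  obtain N where N: "\<And>a. a \<in> A \<Longrightarrow> a < N"
    using assms(2) finite_nat_set_iff_bounded by auto
  show thesis
    by (rule that[of "map (\<lambda>x. x + N) xs"])
      (use assms(1) N in \<open>fastforce simp: word_map inj_on_def\<close>)+
qed

lemma sums_add:
  assumes "s \<in> sums C" "t \<in> sums C"
  shows "s + t \<in> sums C"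
proof -
  obtain cs xs where 1: "length cs = length xs" "color_sum cs = s" "word cs xs \<in> C"
    using assms(1) unfolding sums_def by blast
  obtain ds ys where 2: "length ds = length ys" "color_sum ds = t" "word ds ys \<in> C"
    using assms(2) unfolding sums_def by blast
  obtain zs where 3: "length zs = length ys" "word ds zs \<in> C" "set zs \<inter> set xs = {}"
    using word_fresh_copy[OF 2(3) finite_set] .
  have "word (cs @ ds) (xs @ zs) \<in> C" by (rule word_append) (use 1 3 in auto)
  then show ?thesis unfolding sums_def using 1 2 3
    by (intro CollectI exI[of _ "cs @ ds"] exI[of _ "xs @ zs"]) simp
qed

lemma sums_uminus:
  assumes "s \<in> sums C"
  shows "- s \<in> sums C"
proof -
  obtain cs xs where 1: "length cs = length xs" "color_sum cs = s" "word cs xs \<in> C"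
    using assms unfolding sums_def by blast
  then show ?thesis
    using word_reverse[OF 1(3,1)] unfolding sums_def
    by (intro CollectI exI[of _ "rev (map inverse_color cs)"] exI[of _ "rev xs"]) simp
qed

lemma sums_zero: "0 \<in> sums C"
  using empty_mem unfolding sums_def by (intro CollectI exI[of _ "[]"]) simp

text \<open>
  The color sums form a subgroup of the integers.
\<close>

lemma sums_generator: obtains k :: nat where "sums C = {s. int k dvd s}"
proof (cases "\<exists>n > 0. int n \<in> sums C")
  case False
  have "s = 0" if "s \<in> sums C" for s
  proof (rule ccontr)
    assume "s \<noteq> 0"
    moreover have "int (nat \<bar>s\<bar>) \<in> sums C" using that sums_uminus[OF that] by (simp add: abs_if)
    ultimately show False using False by (metis zero_less_abs_iff zero_less_nat_eq)
  qed
  then have "sums C = {s. int 0 dvd s}" using sums_zero by auto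
  then show thesis by (rule that)
next
  case True
  define k where "k = (LEAST n. n > 0 \<and> int n \<in> sums C)"
  have k: "k > 0" "int k \<in> sums C"
    using LeastI_ex[OF True[unfolded Bex_def]] unfolding k_def by auto
  have least: "k \<le> n" if "n > 0" "int n \<in> sums C" for n
    unfolding k_def using that by (intro Least_le) simp
  have nat_mult: "int k * int n \<in> sums C" for n
  proof (induction n)
    case (Suc n)
    then show ?case using sums_add[OF k(2) Suc] by (simp add: algebra_simps)
  qed (use sums_zero in simp)
  have mult: "int k * z \<in> sums C" for z
    using nat_mult[of "nat z"] sums_uminus[OF nat_mult[of "nat (- z)"]]
    by (cases "z \<ge> 0") auto
  have "int k dvd s" if s: "s \<in> sums C" for s
  proof (rule ccontr)
    assume "\<not> int k dvd s"
    then have "s mod int k \<noteq> 0" by (simp add: dvd_eq_mod_eq_0)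
    then have pos: "0 < s mod int k" "s mod int k < int k" using k(1) by (simp_all add: order.not_eq_order_implies_strict)
    have "s mod int k = s + int k * (- (s div int k))" by (simp add: minus_mult_div_eq_mod)
    then have "s mod int k \<in> sums C" using sums_add[OF s mult[of "- (s div int k)"]] by simp
    then show False using least[of "nat (s mod int k)"] pos by simp
  qed
  then have "sums C = {s. int k dvd s}" using mult by auto
  then show thesis by (rule that)
qed

end

context globally_colorized_category
begin

lemma word_mem_if_shape_balanced:
  assumes "xs \<in> shapes C" "length cs = length xs" "color_sum cs = 0"
  shows "word cs xs \<in> C"
  using assms word_recolor unfolding shapes_def by auto

lemma even_shape:
  assumes "xs \<in> shapes C"
  shows "even (length xs)"
proof -
  obtain cs where "length cs = length xs" "color_sum cs = 0" using assms unfolding shapes_def by blast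
  then show ?thesis using even_color_sum_iff[of cs] by simp
qed

sublocale shape_category "shapes C"
proof
  fix xs and f :: "nat \<Rightarrow> nat" assume "xs \<in> shapes C" "inj_on f (set xs)"
  then show "map f xs \<in> shapes C" unfolding shapes_def by (auto simp: word_map)
next
  fix xs ys assume *: "xs \<in> shapes C" "ys \<in> shapes C" "set xs \<inter> set ys = {}"
  then obtain cs ds where "length cs = length xs" "color_sum cs = 0" "word cs xs \<in> C"
    "length ds = length ys" "color_sum ds = 0" "word ds ys \<in> C" unfolding shapes_def by auto
  then show "xs @ ys \<in> shapes C"
    using word_append *(3) unfolding shapes_def by (intro CollectI exI[of _ "cs @ ds"]) simp
next
  fix xs ys assume "xs @ ys \<in> shapes C"
  then obtain cs where cs: "length cs = length (xs @ ys)" "color_sum cs = 0" "word cs (xs @ ys) \<in> C"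
    unfolding shapes_def by blast
  let ?u = "take (length xs) cs" and ?v = "drop (length xs) cs"
  have "word (?v @ ?u) (ys @ xs) \<in> C"
    by (rule word_rotate) (use cs in simp_all)
  moreover have "color_sum (?v @ ?u) = color_sum (?u @ ?v)" by (simp only: color_sum_simps add.commute)
  then have "color_sum (?v @ ?u) = 0" using cs by simp
  ultimately show "ys @ xs \<in> shapes C"
    unfolding shapes_def using cs(1) by (intro CollectI exI[of _ "?v @ ?u"]) simp
next
  fix xs a b ys assume *: "xs @ a # b # ys \<in> shapes C"
  then have "even (length xs + length ys)" using even_shape by fastforce
  then obtain n where n: "length xs + length ys = 2 * n" by blast
  define w where "w = replicate n White @ replicate n Black"
  define u v where "u = take (length xs) w" and "v = drop (length xs) w"
  have len: "length u = length xs" "length v = length ys" using n by (simp_all add: u_def v_def w_def)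
  have "color_sum (u @ v) = 0" by (simp add: u_def v_def) (simp add: w_def)
  then have uv: "color_sum u + color_sum v = 0" by simp
  have "word (u @ White # inverse_color White # v) (xs @ a # b # ys) \<in> C"
    by (rule word_mem_if_shape_balanced[OF *]) (use len uv in simp_all)
  from word_cap[OF this len] have "word (u @ v) (map (id(b := a)) (xs @ ys)) \<in> C" .
  then show "map (id(b := a)) (xs @ ys) \<in> shapes C"
    unfolding shapes_def using len uv by (intro CollectI exI[of _ "u @ v"]) simp
next
  fix xs assume "xs \<in> shapes C"
  then obtain cs where "length cs = length xs" "color_sum cs = 0" "word cs xs \<in> C"
    unfolding shapes_def by blast
  then show "rev xs \<in> shapes C"
    using word_reverse[of cs xs] unfolding shapes_def
    by (intro CollectI exI[of _ "rev (map inverse_color cs)"]) simp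
next
  fix a show "[a, a] \<in> shapes C"
    unfolding shapes_def using pair_mem[of White a]
    by (intro CollectI exI[of _ "[White, Black]"]) simp
qed (rule even_shape)

lemma word_cancel_balanced:
  assumes "word (cs @ replicate n White @ replicate n Black) (xs @ ys) \<in> C"
    and "set xs \<inter> set ys = {}" "length cs = length xs" "length ys = 2 * n"
  shows "word cs xs \<in> C"
  using assms
proof (induction n arbitrary: ys)
  case (Suc n)
  define us vs where "us = take n ys" and "vs = drop (Suc (Suc n)) ys"
  define a b where "a = ys ! n" and "b = ys ! Suc n"
  have ys: "ys = us @ a # b # vs"
    unfolding us_def vs_def a_def b_def using Suc.prems(4)
    by (simp add: Cons_nth_drop_Suc)
  have len: "length us = n" "length vs = n" using Suc.prems(4) by (simp_all add: us_def vs_def)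
  have "word ((cs @ replicate n White) @ White # inverse_color White # replicate n Black)
      ((xs @ us) @ a # b # vs) \<in> C"
    using Suc.prems(1) ys by (simp add: replicate_app_Cons_same)
  from word_cap[OF this] len Suc.prems(3)
  have "word (cs @ replicate n White @ replicate n Black) (map (id(b := a)) (xs @ us @ vs)) \<in> C"
    by simp
  moreover have "map (id(b := a)) xs = xs" by (rule map_idI) (use ys Suc.prems(2) in auto)
  ultimately have "word (cs @ replicate n White @ replicate n Black) (xs @ map (id(b := a)) (us @ vs)) \<in> C"
    by simp
  then show ?case
    by (rule Suc.IH) (use Suc.prems len ys in auto)
qed simp

text \<open>
  The colors can be arranged such that \<open>ys\<close> carries as many white as black points; then it can be
  capped away.
\<close>

lemma word_cancel:
  assumes "word cs (xs @ ys) \<in> C" "length cs = length (xs @ ys)" "set xs \<inter> set ys = {}"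
    and "even (length ys)" "length ds = length xs" "color_sum ds = color_sum cs"
  shows "word ds xs \<in> C"
proof -
  obtain n where n: "length ys = 2 * n" using assms(4) by blast
  have "word (ds @ replicate n White @ replicate n Black) (xs @ ys) \<in> C"
    by (rule word_recolor[OF assms(1)]) (use assms n in simp_all)
  then show ?thesis by (rule word_cancel_balanced) (use assms n in simp_all)
qed

text \<open>
  Append a further copy of \<open>ys\<close> in its original colors. Then \<open>rev ys\<close> and this copy form a part of
  even length, which is canceled.
\<close>

lemma word_mem_if_append_reverse_mem:
  assumes "length cs = length xs" "length ds = length ys" "set xs \<inter> set ys = {}"
    and "word ds ys \<in> C" "color_sum cs = color_sum ds" "xs @ rev ys \<in> shapes C"
  shows "word cs xs \<in> C"
proof -
  obtain zs where zs: "length zs = length ys" "word ds zs \<in> C" "set zs \<inter> set (xs @ ys) = {}"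
    using word_fresh_copy[OF assms(4) finite_set] .
  have "word (cs @ rev (map inverse_color ds)) (xs @ rev ys) \<in> C"
    by (rule word_mem_if_shape_balanced) (use assms in simp_all)
  then have "word ((cs @ rev (map inverse_color ds)) @ ds) ((xs @ rev ys) @ zs) \<in> C"
    by (rule word_append) (use zs assms in auto)
  then show ?thesis
    by (intro word_cancel[of "(cs @ rev (map inverse_color ds)) @ ds" xs "rev ys @ zs"])
      (use zs assms in auto)
qed

lemma append_reverse_shape:
  assumes "word cs xs \<in> C" "length cs = length xs" "word ds ys \<in> C" "length ds = length ys"
    and "set xs \<inter> set ys = {}" "color_sum cs = color_sum ds"
  shows "xs @ rev ys \<in> shapes C"
proof -
  have "word (cs @ rev (map inverse_color ds)) (xs @ rev ys) \<in> C"
    by (rule word_append[OF assms(1) word_reverse]) (use assms in auto)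
  then show ?thesis
    unfolding shapes_def using assms
    by (intro CollectI exI[of _ "cs @ rev (map inverse_color ds)"]) simp
qed

text \<open>
  A word with the required color sum followed by its reflection is a shape. The length of the word is
  even, so it can be capped away, and its reflection alone is a shape. Hence so is \<open>xs\<close> followed by this
  reflection.
\<close>

lemma word_mem_if_shape:
  assumes "xs \<in> shapes C" "length cs = length xs" "color_sum cs \<in> sums C"
  shows "word cs xs \<in> C"
proof -
  obtain ds ys0 where ds: "length ds = length ys0" "color_sum ds = color_sum cs" "word ds ys0 \<in> C"
    using assms(3) unfolding sums_def by blast
  obtain ys where ys: "length ys = length ys0" "word ds ys \<in> C" "set ys \<inter> set xs = {}"
    using word_fresh_copy[OF ds(3) finite_set] .
  obtain zs where zs: "length zs = length ys0" "word ds zs \<in> C" "set zs \<inter> set (xs @ ys) = {}"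
    using word_fresh_copy[OF ds(3) finite_set] .
  have "even (length ys)"
    using even_color_sum_iff[of ds] even_color_sum_iff[of cs] ds assms(2) ys(1) even_shape[OF assms(1)] by simp
  have "ys @ rev zs \<in> shapes C"
    by (rule append_reverse_shape[OF ys(2) _ zs(2)]) (use ds ys zs in auto)
  then have "[] @ rev zs \<in> shapes C"
    using infix_reduce[of "[]" ys "rev zs"] \<open>even (length ys)\<close> zs(3) by auto
  then have "xs @ rev zs \<in> shapes C" using append[OF assms(1), of "rev zs"] zs(3) by (simp add: Int_commute Int_Un_distrib)
  then show ?thesis
    by (intro word_mem_if_append_reverse_mem[OF assms(2) _ _ zs(2)]) (use ds zs in auto)
qed

lemma distinct_shape:
  assumes "[0, 1] \<in> shapes C" "distinct xs" "even (length xs)"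
  shows "xs \<in> shapes C"
proof (rule alternating_mem[OF _ _ assms(3,1)])
  show "noncrossing_word xs" unfolding noncrossing_word_def using assms(2) by (auto simp: nth_eq_iff_index_eq)
  show "alternating xs" unfolding alternating_def using assms(2) by (auto simp: nth_eq_iff_index_eq)
qed

text \<open>
  For an odd number of points the list is not itself a shape. Yet a word with the required color sum
  followed by its reflection reduces to one singleton followed by that reflection, and the other
  singletons are inserted in pairs.
\<close>

lemma distinct_word_mem:
  assumes "[0, 1] \<in> shapes C" "distinct xs" "length cs = length xs" "color_sum cs \<in> sums C"
  shows "word cs xs \<in> C"
proof (cases "even (length xs)")
  case True
  then show ?thesis using word_mem_if_shape[OF distinct_shape] assms by blast
next
  case False
  then obtain x xs' where xs: "xs = x # xs'" by (cases xs) auto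
  obtain ds ys0 where ds: "length ds = length ys0" "color_sum ds = color_sum cs" "word ds ys0 \<in> C"
    using assms(4) unfolding sums_def by blast
  obtain ys where ys: "length ys = length ys0" "word ds ys \<in> C" "set ys \<inter> set xs = {}"
    using word_fresh_copy[OF ds(3) finite_set] .
  obtain zs where zs: "length zs = length ys0" "word ds zs \<in> C" "set zs \<inter> set (xs @ ys) = {}"
    using word_fresh_copy[OF ds(3) finite_set] .
  have odd: "odd (length ys)"
    using even_color_sum_iff[of ds] even_color_sum_iff[of cs] ds assms(3) ys(1) False by simp
  have "ys @ rev zs \<in> shapes C"
    by (rule append_reverse_shape[OF ys(2) _ zs(2)]) (use ds ys zs in auto)
  then obtain s where s: "s \<notin> set zs" "[s] @ rev zs \<in> shapes C"
    using infix_reduce[of "[]" ys "rev zs"] odd zs(3) by auto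
  have "map (id(s := x)) ([s] @ rev zs) \<in> shapes C"
    by (rule relabel[OF s(2)]) (use s(1) zs(3) xs in \<open>auto simp: inj_on_def\<close>)
  moreover have "map (id(s := x)) (rev zs) = rev zs" by (rule map_idI) (use s(1) in auto)
  ultimately have x: "[x] @ rev zs \<in> shapes C" by simp
  have "[x] @ xs' @ rev zs \<in> shapes C"
    by (rule insert[OF x distinct_shape[OF assms(1)]]) (use assms(2) False xs zs(3) in auto)
  then show ?thesis
    by (intro word_mem_if_append_reverse_mem[OF assms(3) _ _ zs(2)]) (use xs ds zs in auto)
qed

lemma odd_sum_parts:
  assumes "s \<in> sums C" "odd s"
  obtains cs xs ys where "word cs xs \<in> C" "word cs ys \<in> C" "length cs = length xs" "length ys = length xs"
    "odd (length xs)" "set xs \<inter> set ys = {}"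
proof -
  obtain cs xs where 1: "length cs = length xs" "color_sum cs = s" "word cs xs \<in> C"
    using assms(1) unfolding sums_def by blast
  obtain ys where 2: "length ys = length xs" "word cs ys \<in> C" "set ys \<inter> set xs = {}"
    using word_fresh_copy[OF 1(3) finite_set] .
  show thesis
    by (rule that[OF 1(3) 2(2) 1(1) 2(1)]) (use even_color_sum_iff[of cs] 1 2 assms(2) in auto)
qed

text \<open>
  A word followed by its reflection is a shape that consists of two disjoint parts of odd length.
\<close>

lemma singletons_if_odd_sum:
  assumes "s \<in> sums C" "odd s"
  shows "[0, 1] \<in> shapes C"
proof -
  obtain cs xs ys where 1: "word cs xs \<in> C" "word cs ys \<in> C" "length cs = length xs" "length ys = length xs"
    "odd (length xs)" "set xs \<inter> set ys = {}"
    using odd_sum_parts[OF assms] .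
  have "xs @ rev ys \<in> shapes C" by (rule append_reverse_shape[OF 1(1) _ 1(2)]) (use 1 in auto)
  then show ?thesis by (rule singletons_if_odd_parts) (use 1 in auto)
qed

text \<open>
  A word of odd length is put inside a pair, and its reflection outside of it.
\<close>

lemma lambda_if_odd_sum:
  assumes "s \<in> sums C" "odd s"
  shows "[0, 1, 2, 1] \<in> shapes C"
proof -
  obtain cs xs ys where 1: "word cs xs \<in> C" "word cs ys \<in> C" "length cs = length xs" "length ys = length xs"
    "odd (length xs)" "set xs \<inter> set ys = {}"
    using odd_sum_parts[OF assms] .
  obtain a where a: "a \<notin> set (xs @ ys)" by (rule fresh_nat)
  have "word ([White, Black] @ cs) ([a, a] @ xs) \<in> C"
    using word_append[OF pair_mem[of White a] 1(1)] a by simp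
  then have "word ([Black] @ cs @ [White]) ([a] @ xs @ [a]) \<in> C"
    using word_rotate[of "[White]" "Black # cs" "[a]" "a # xs"] 1 by simp
  then have "([a] @ xs @ [a]) @ rev ys \<in> shapes C"
    by (rule append_reverse_shape[OF _ _ 1(2)]) (use 1 a in auto)
  then have "[a] @ xs @ [a] @ rev ys \<in> shapes C" by simp
  then show ?thesis by (rule lambda_if_odd_arcs) (use 1 a in auto)
qed

lemma shape_iff:
  assumes "length cs = length xs" "color_sum cs = 0"
  shows "xs \<in> shapes C \<longleftrightarrow> word cs xs \<in> C"
  using assms word_mem_if_shape_balanced[OF _ assms] unfolding shapes_def by blast

lemma four_block_iff: "\<beta> White Black White Black \<in> C \<longleftrightarrow> [0, 0, 0, 0] \<in> shapes C"
  using shape_iff[of "[White, Black, White, Black]" "[0, 0, 0, 0]"]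
  by (simp add: four_block_labelled[of _ _ _ _ 0])

lemma lambda_iff: "lambda1 \<in> C \<longleftrightarrow> [0, 1, 2, 1] \<in> shapes C"
  using shape_iff[of "[White, White, Black, Black]" "[0, 1, 2, 1]"]
  by (simp add: lambda1_labelled)

lemma singletons_iff: "\<sigma> White \<otimes> \<sigma> Black \<in> C \<longleftrightarrow> [0, 1] \<in> shapes C"
proof -
  have "\<sigma> White \<otimes> \<sigma> Black = word [White, Black] [0, 1]"
    unfolding singleton_part_labelled[of White 0] singleton_part_labelled[of Black 1]
    using tensor_labelled[of "[]" "[]" "[White]" "[0 :: nat]" "[]" "[1]" "[]" "[Black]"] by simp
  then show ?thesis using shape_iff[of "[White, Black]" "[0, 1]"] by simp
qed

end

section \<open>Comparing categories\<close>

text \<open>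
  For a word of \<open>C\<close> choose a word of \<open>D\<close> with the same color sum. The first followed by the reflection
  of the second is a shape of \<open>C\<close>, hence of \<open>D\<close>, and in \<open>D\<close> the second word can be canceled again.
\<close>

lemma subset_if_shapes_subset:
  assumes "globally_colorized_category C" "globally_colorized_category D"
    and "D \<subseteq> C" "shapes C \<subseteq> shapes D" "sums C \<subseteq> sums D"
  shows "C \<subseteq> D"
proof
  interpret C: globally_colorized_category C by fact
  interpret D: globally_colorized_category D by fact
  fix p assume p: "p \<in> C"
  then have "p \<in> all_two_colored" using C.category unfolding category_def by blast
  then obtain k l where kl: "p \<in> two_colored k l" unfolding all_two_colored_def by blast
  obtain xs ys :: "nat list" where xy: "length xs = k" "length ys = l"
    "p = labelled (upper_colors p) (lower_colors p) xs ys"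
    using two_colored_labelled[OF kl] .
  have len: "length (upper_colors p) = length xs" "length (lower_colors p) = length ys"
    using kl xy unfolding two_colored_def by simp_all
  define cs where "cs = rev (map inverse_color (upper_colors p)) @ lower_colors p"
  define zs where "zs = rev xs @ ys"
  have cz: "length cs = length zs" unfolding cs_def zs_def using len by simp
  have wC: "word cs zs \<in> C"
    using p C.labelled_mem_iff_word_mem[OF len] xy(3) unfolding cs_def zs_def by metis
  then have "color_sum cs \<in> sums D" using cz assms(5) unfolding sums_def by blast
  then obtain ds ws0 where ds: "length ds = length ws0" "color_sum ds = color_sum cs" "word ds ws0 \<in> D"
    unfolding sums_def by blast
  obtain ws where ws: "length ws = length ws0" "word ds ws \<in> D" "set ws \<inter> set zs = {}"
    using D.word_fresh_copy[OF ds(3) finite_set] .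
  have "zs @ rev ws \<in> shapes C"
    by (rule C.append_reverse_shape[OF wC cz, where ds = ds]) (use ws ds assms(3) in auto)
  then have "word cs zs \<in> D"
    using assms(4) by (intro D.word_mem_if_append_reverse_mem[OF cz _ _ ws(2)]) (use ws ds in auto)
  then show "p \<in> D"
    using D.labelled_mem_iff_word_mem[OF len] xy(3) unfolding cs_def zs_def by metis
qed

lemma category_generated:
  assumes "category C" "X \<subseteq> C"
  shows "category (generated X)"
proof -
  have "generated X \<subseteq> C" unfolding generated_def using assms by blast
  then have "generated X \<subseteq> all_two_colored" using assms(1) unfolding category_def by blast
  then show ?thesis unfolding category_def[of "generated X"] unfolding generated_def category_def by blast
qed

text \<open>
  The generated category contains a word of color sum \<open>k\<close>, so its color sums are those of \<open>C\<close>.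
  Only the shapes remain to be compared.
\<close>

lemma eq_generated:
  assumes C: "globally_colorized_category C" and X: "X \<subseteq> C" "\<pi> White White \<otimes> \<pi> Black Black \<in> X"
    and sums: "sums C = {s. int k dvd s}" "word cs xs \<in> X" "length cs = length xs" "color_sum cs = int k"
    and shapes: "\<And>xs. xs \<in> shapes C \<Longrightarrow> globally_colorized_category (generated X) \<Longrightarrow>
      xs \<in> shapes (generated X)"
  shows "C = generated X"
proof
  interpret C: globally_colorized_category C by fact
  have gen: "X \<subseteq> generated X" unfolding generated_def by blast
  show sub: "generated X \<subseteq> C" unfolding generated_def using C.category X(1) by blast
  interpret D: globally_colorized_category "generated X"
    by unfold_locales (use category_generated[OF C.category X(1)] X(2) gen in \<open>auto simp: globally_colorized_def\<close>)
  have D: "globally_colorized_category (generated X)" by unfold_locales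
  have k: "int k \<in> sums (generated X)" using sums(2-4) gen unfolding sums_def by blast
  have "sums C \<subseteq> sums (generated X)"
  proof -
    obtain m where m: "sums (generated X) = {s. int m dvd s}" using D.sums_generator .
    then show ?thesis using k sums(1) by (auto intro: dvd_trans)
  qed
  then show "C \<subseteq> generated X"
    using subset_if_shapes_subset[OF C D sub] shapes D by blast
qed

section \<open>The classification\<close>

text \<open>
  The lower row is traversed from right to left in the clockwise order, so the four positions
  are used in reversed order.
\<close>

lemma noncrossing_word_if_noncrossing:
  assumes "word cs xs \<in> noncrossing" "length cs = length xs"
  shows "noncrossing_word xs"
  unfolding noncrossing_word_def
proof (intro allI impI, elim conjE, rule ccontr)
  fix i j k l
  assume lt: "i < j" "j < k" "k < l" "l < length xs" and eq: "xs ! i = xs ! k" "xs ! j = xs ! l"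
    and ne: "xs ! i \<noteq> xs ! j"
  define B where "B p = {q \<in> points 0 (length xs). label [] xs q = label [] xs (Lower p)}" for p
  have blk: "B p \<in> blocks (word cs xs)" if "p < length xs" for p
    unfolding labelled_def B_def using that by (auto intro!: image_eqI[of _ _ "Lower p"])
  have in_B: "Lower q \<in> B p \<longleftrightarrow> q < length xs \<and> xs ! q = xs ! p" for p q
    unfolding B_def by auto
  have cw: "clockwise (word cs xs) (Lower q) = length xs - 1 - q" for q
    using assms(2) by (simp add: labelled_def)
  have "B l \<noteq> B k" using in_B[of l l] in_B[of l k] lt eq ne by auto
  moreover have "\<exists>a \<in> B l. \<exists>b \<in> B k. \<exists>c \<in> B l. \<exists>d \<in> B k.
      clockwise (word cs xs) a < clockwise (word cs xs) b \<and>
      clockwise (word cs xs) b < clockwise (word cs xs) c \<and>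
      clockwise (word cs xs) c < clockwise (word cs xs) d"
    by (rule bexI[where x = "Lower l"], rule bexI[where x = "Lower k"],
        rule bexI[where x = "Lower j"], rule bexI[where x = "Lower i"])
      (use in_B lt eq in \<open>auto simp only: cw; linarith\<close>)+
  ultimately have "crossing (word cs xs)"
    unfolding crossing_def using blk[of l] blk[of k] lt by (meson less_trans)
  then show False using assms(1) unfolding noncrossing_def by simp
qed

lemma tensor_power_singleton:
  obtains xs :: "nat list" where "tensor_power (\<sigma> White) k = word (replicate k White) xs"
    "length xs = k" "distinct xs"
proof (induction k arbitrary: thesis)
  case 0
  show ?case by (rule 0[of "[]"]) (simp_all add: empty_partition_labelled)
next
  case (Suc k)
  obtain xs :: "nat list" where xs: "tensor_power (\<sigma> White) k = word (replicate k White) xs"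
    "length xs = k" "distinct xs" using Suc.IH .
  have "tensor_power (\<sigma> White) (Suc k) = \<sigma> White \<otimes> word (replicate k White) xs"
    by (simp add: xs(1))
  also have "\<dots> = word [White] [0] \<otimes> word (replicate k White) (map Suc xs)"
    by (simp add: word_map singleton_part_labelled[of _ 0])
  also have "\<dots> = word ([White] @ replicate k White) ([0] @ map Suc xs)"
    by (subst tensor_labelled) auto
  finally show ?case
    by (intro Suc.prems[of "0 # map Suc xs"]) (simp_all add: xs distinct_map)
qed

lemma (in globally_colorized_category) tensor_power_pair:
  obtains xs where "tensor_power (\<pi> White White) m = word (replicate (2 * m) White) xs"
    "length xs = 2 * m" "xs \<in> shapes C"
proof (induction m arbitrary: thesis)
  case 0
  show ?case by (rule 0[of "[]"]) (simp_all add: empty_partition_labelled shape_category.empty_mem[OF shape_category_axioms])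
next
  case (Suc m)
  obtain xs where xs: "tensor_power (\<pi> White White) m = word (replicate (2 * m) White) xs"
    "length xs = 2 * m" "xs \<in> shapes C" using Suc.IH .
  have "tensor_power (\<pi> White White) (Suc m) = \<pi> White White \<otimes> word (replicate (2 * m) White) xs"
    by (simp add: xs(1))
  also have "\<dots> = word [White, White] [0, 0] \<otimes> word (replicate (2 * m) White) (map Suc xs)"
    by (simp add: word_map pair_part_labelled[of _ _ 0])
  also have "\<dots> = word ([White, White] @ replicate (2 * m) White) ([0, 0] @ map Suc xs)"
    by (subst tensor_labelled) auto
  finally have eq: "tensor_power (\<pi> White White) (Suc m) =
      word (replicate (2 * Suc m) White) ([0, 0] @ map Suc xs)" by simp
  have "[0, 0] @ map Suc xs \<in> shapes C"
    by (rule append[OF pair relabel[OF xs(3)]]) auto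
  then show ?case by (intro Suc.prems[OF eq]) (simp_all add: xs(2))
qed

theorem theorem7p1:
  fixes C :: "partition set"
  assumes "category C" and "C \<subseteq> noncrossing" and "globally_colorized C"
  shows "(case_O C \<and> (\<exists>k. even k \<and> C = O_glob k)) \<or>
         (case_H C \<and> (\<exists>k. even k \<and> C = H_glob k)) \<or>
         (case_S C \<and> (\<exists>k. C = S_glob k)) \<or>
         (case_B C \<and> ((\<exists>k. even k \<and> C = B_glob k) \<or> (\<exists>k. C = B'_glob k)))"
proof -
  interpret C: globally_colorized_category C by unfold_locales fact+
  have C: "globally_colorized_category C" by unfold_locales
  obtain k where k: "sums C = {s. int k dvd s}" using C.sums_generator .
  have kin: "int k \<in> sums C" unfolding k by simp
  have ncs: "noncrossing_word xs" if "xs \<in> shapes C" for xs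
    using that assms(2) noncrossing_word_if_noncrossing unfolding shapes_def by blast
  have pp: "\<pi> White White \<otimes> \<pi> Black Black \<in> C" using assms(3) by (simp add: globally_colorized_def)
  have small: "count_list xs a \<le> 2" if "[0, 0, 0, 0] \<notin> shapes C" "xs \<in> shapes C" for xs a
    using C.four_block_if_three_occurrences[of xs a] that by linarith
  have evn: "even (count_list xs a)" if "[0, 1] \<notin> shapes C" "xs \<in> shapes C" for xs a
    using C.singletons_if_odd_block[OF ncs[OF that(2)] that(2)] that(1) by blast
  have k_even: "even k" if "[0, 1] \<notin> shapes C \<or> [0, 1, 2, 1] \<notin> shapes C"
    using C.singletons_if_odd_sum[OF kin] C.lambda_if_odd_sum[OF kin] that by auto
  have pos: "count_list xs a > 0" if "a \<in> set xs" for xs :: "nat list" and a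
    using that count_list_0_iff[of xs a] by auto
  obtain ss :: "nat list" where ss: "tensor_power (\<sigma> White) k = word (replicate k White) ss"
    "length ss = k" "distinct ss" by (rule tensor_power_singleton)
  have ssC: "tensor_power (\<sigma> White) k \<in> C" if "[0, 1] \<in> shapes C"
    unfolding ss(1) by (rule C.distinct_word_mem) (use that ss kin in simp_all)
  consider (O) "[0, 1] \<notin> shapes C" "[0, 0, 0, 0] \<notin> shapes C"
    | (H) "[0, 1] \<notin> shapes C" "[0, 0, 0, 0] \<in> shapes C"
    | (S) "[0, 1] \<in> shapes C" "[0, 0, 0, 0] \<in> shapes C"
    | (B) "[0, 1] \<in> shapes C" "[0, 0, 0, 0] \<notin> shapes C" "[0, 1, 2, 1] \<notin> shapes C"
    | (B') "[0, 1] \<in> shapes C" "[0, 0, 0, 0] \<notin> shapes C" "[0, 1, 2, 1] \<in> shapes C"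
    by blast
  then show ?thesis
  proof cases
    case O
    let ?X = "{tensor_power (\<pi> White White) (k div 2), \<pi> White White \<otimes> \<pi> Black Black}"
    have ev: "even k" using k_even O by blast
    obtain ps where ps: "tensor_power (\<pi> White White) (k div 2) = word (replicate (2 * (k div 2)) White) ps"
      "length ps = 2 * (k div 2)" "ps \<in> shapes C" by (rule C.tensor_power_pair)
    have "C = O_glob k"
      unfolding O_glob_def
    proof (rule eq_generated[OF C _ _ k])
      show "word (replicate k White) ps \<in> ?X"
        using ps(1) ev by simp
      have "tensor_power (\<pi> White White) (k div 2) \<in> C"
        unfolding ps(1) by (rule C.word_mem_if_shape) (use ps ev kin in simp_all)
      then show "?X \<subseteq> C"
        using pp by simp
    next
      fix xs assume xs: "xs \<in> shapes C"
      assume "globally_colorized_category (generated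
        ?X)"
      then interpret D: globally_colorized_category "generated ?X" .
      show "xs \<in> shapes (generated ?X)"
      proof (rule D.mem_if_blocks_mem[OF ncs[OF xs]])
        fix a assume "a \<in> set xs"
        then have "count_list xs a = Suc (Suc 0)"
          using small[OF O(2) xs, of a] evn[OF O(1) xs, of a] pos[of a xs] by presburger
        then show "replicate (count_list xs a) a \<in> shapes (generated ?X)" using D.pair by simp
      qed
    qed (use ps ev in simp_all)
    moreover have "case_O C" using O by (simp add: case_O_def C.singletons_iff C.four_block_iff)
    ultimately show ?thesis using ev by blast
  next
    case H
    let ?X = "{white_block k, \<beta> White Black White Black, \<pi> White White \<otimes> \<pi> Black Black}"
    have ev: "even k" using k_even H by blast
    have "C = H_glob k"
      unfolding H_glob_def
    proof (rule eq_generated[OF C _ _ k])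
      show "word (replicate k White) (replicate k 0) \<in> ?X"
        by (simp add: white_block_labelled[of _ 0])
      have "replicate k 0 \<in> shapes C"
        using C.even_block_mem[OF H(2), of "k div 2" 0] ev by simp
      then have "white_block k \<in> C"
        unfolding white_block_labelled[of _ 0] by (rule C.word_mem_if_shape) (use kin in simp_all)
      then show "?X \<subseteq> C"
        using pp H by (simp add: C.four_block_iff)
    next
      fix xs assume xs: "xs \<in> shapes C"
      assume "globally_colorized_category (generated
        ?X)"
      then interpret D: globally_colorized_category "generated ?X" .
      have "\<beta> White Black White Black \<in> generated ?X" unfolding generated_def by blast
      then have four: "[0, 0, 0, 0] \<in> shapes (generated ?X)" by (simp add: D.four_block_iff)
      show "xs \<in> shapes (generated ?X)"
      proof (rule D.mem_if_blocks_mem[OF ncs[OF xs]])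
        fix a
        obtain n where "count_list xs a = 2 * n" using evn[OF H(1) xs, of a] by blast
        then show "replicate (count_list xs a) a \<in> shapes (generated ?X)" using D.even_block_mem[OF four] by simp
      qed
    qed simp_all
    moreover have "case_H C" using H by (simp add: case_H_def C.singletons_iff C.four_block_iff)
    ultimately show ?thesis using ev by blast
  next
    case S
    let ?X = "{tensor_power (\<sigma> White) k, \<beta> White Black White Black,
      \<sigma> White \<otimes> \<sigma> Black, \<pi> White White \<otimes> \<pi> Black Black}"
    have "C = S_glob k"
      unfolding S_glob_def
    proof (rule eq_generated[OF C _ _ k])
      show "word (replicate k White) ss \<in> ?X"
        using ss(1) by simp
      show "?X \<subseteq> C"
        using ssC pp S by (simp add: C.four_block_iff C.singletons_iff)
    next
      fix xs assume xs: "xs \<in> shapes C"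
      assume "globally_colorized_category (generated ?X)"
      then interpret D: globally_colorized_category "generated ?X" .
      have "\<beta> White Black White Black \<in> generated ?X" "\<sigma> White \<otimes> \<sigma> Black \<in> generated ?X"
        unfolding generated_def by blast+
      then have D: "[0, 0, 0, 0] \<in> shapes (generated ?X)" "[0, 1] \<in> shapes (generated ?X)"
        by (simp_all add: D.four_block_iff D.singletons_iff)
      show "xs \<in> shapes (generated ?X)"
        by (rule D.mem_if_blocks_mem_singletons[OF ncs[OF xs] D.lambda_if_four_block[OF D] D(2)
            C.even_shape[OF xs]]) (rule D.even_block_mem[OF D(1)])
    qed (use ss in simp_all)
    moreover have "case_S C" using S by (simp add: case_S_def C.singletons_iff C.four_block_iff)
    ultimately show ?thesis by blast
  next
    case B
    let ?X = "{tensor_power (\<sigma> White) k, \<sigma> White \<otimes> \<sigma> Black,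
      \<pi> White White \<otimes> \<pi> Black Black}"
    have ev: "even k" using k_even B by blast
    have "C = B_glob k"
      unfolding B_glob_def
    proof (rule eq_generated[OF C _ _ k])
      show "word (replicate k White) ss \<in> ?X"
        using ss(1) by simp
      show "?X \<subseteq> C"
        using ssC pp B by (simp add: C.singletons_iff)
    next
      fix xs assume xs: "xs \<in> shapes C"
      assume "globally_colorized_category (generated ?X)"
      then interpret D: globally_colorized_category "generated ?X" .
      have "\<sigma> White \<otimes> \<sigma> Black \<in> generated ?X" unfolding generated_def by blast
      then have D: "[0, 1] \<in> shapes (generated ?X)" by (simp add: D.singletons_iff)
      have "alternating xs" using C.lambda_if_not_alternating[OF ncs[OF xs] xs B(2)] B(3) by blast
      then show "xs \<in> shapes (generated ?X)" using D.alternating_mem[OF ncs[OF xs] _ C.even_shape[OF xs] D] by blast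
    qed (use ss in simp_all)
    moreover have "case_B C" using B by (simp add: case_B_def C.singletons_iff C.four_block_iff)
    ultimately show ?thesis using ev by blast
  next
    case B'
    let ?X = "{tensor_power (\<sigma> White) k, lambda1, \<sigma> White \<otimes> \<sigma> Black,
      \<pi> White White \<otimes> \<pi> Black Black}"
    have "C = B'_glob k"
      unfolding B'_glob_def
    proof (rule eq_generated[OF C _ _ k])
      show "word (replicate k White) ss \<in> ?X"
        using ss(1) by simp
      show "?X \<subseteq> C"
        using ssC pp B' by (simp add: C.singletons_iff C.lambda_iff)
    next
      fix xs assume xs: "xs \<in> shapes C"
      assume "globally_colorized_category (generated ?X)"
      then interpret D: globally_colorized_category "generated ?X" .
      have "lambda1 \<in> generated ?X" "\<sigma> White \<otimes> \<sigma> Black \<in> generated ?X" unfolding generated_def by blast+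
      then have D: "[0, 1, 2, 1] \<in> shapes (generated ?X)" "[0, 1] \<in> shapes (generated ?X)"
        by (simp_all add: D.lambda_iff D.singletons_iff)
      show "xs \<in> shapes (generated ?X)"
      proof (rule D.mem_if_blocks_mem_singletons[OF ncs[OF xs] D C.even_shape[OF xs]])
        fix a assume "a \<in> set xs"
        then have "2 * ((count_list xs a + 1) div 2) = Suc (Suc 0)"
          using small[OF B'(2) xs, of a] pos[of a xs] by presburger
        then show "replicate (2 * ((count_list xs a + 1) div 2)) a \<in> shapes (generated ?X)" using D.pair by simp
      qed
    qed (use ss in simp_all)
    moreover have "case_B C" using B' by (simp add: case_B_def C.singletons_iff C.four_block_iff)
    ultimately show ?thesis by blast
  qed
qed

end
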